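(* Let $k\in\mathbb C$, let $a\neq0$ and $\kappa$ be arbitrary (complex) constants, and let $\beta(t)=a/\mathrm{sn}(at\,|\,\kappa)$. Put $\partial_i=\partial/\partial t_i$ and $t_{ij}=t_i-t_j$ for $1\le i,j\le 3$. Then the $3\times3$ matrix-valued differential operators $$P_1=\partial_1+\partial_2+\partial_3,$$ $$P_2=\partial_1\partial_2+\partial_2\partial_3+\partial_3\partial_1+k(k-1)\sum_{1\le i<j\le3}\beta(t_{ij})^2+k\begin{pmatrix}\beta(t_{12})^2+\beta(t_{13})^2&\beta'(t_{12})&\beta'(t_{13})\\ \beta'(t_{12})&\beta(t_{12})^2+\beta(t_{23})^2&\beta'(t_{23})\\ \beta'(t_{13})&\beta'(t_{23})&\beta(t_{23})^2+\beta(t_{13})^2\end{pmatrix},$$ $$Q_1=\begin{pmatrix}\partial_1&0&0\\0&\partial_2&0\\0&0&\partial_3\end{pmatrix}+k\begin{pmatrix}0&-\beta(t_{12})&-\beta(t_{13})\\ \beta(t_{12})&0&-\beta(t_{23})\\ \beta(t_{13})&\beta(t_{23})&0\end{pmatrix}$$ mutually commute.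
   Context: $\mathrm{sn}(u\,|\,\kappa)$ is the Jacobi elliptic function sn with modulus $\kappa$, i.e. the meromorphic function $y(u)$ with $y'^2=(1-y^2)(1-\kappa^2y^2)$, $y(0)=0$, $y'(0)=1$. Thus $\beta$ is an odd meromorphic function with a simple pole at the origin, and $\beta'$ is its derivative. Scalar operators are understood as multiplied by the $3\times3$ identity matrix; the operators act on $\mathbb C^3$-valued functions of $(t_1,t_2,t_3)$. *)

theory Defs
  imports "HOL-Complex_Analysis.Complex_Analysis"
begin

(* y is the Jacobi elliptic function sn with complex modulus \<kappa>. The normalisation
   "nicely meromorphic" (removable singularities removed, value 0 at the poles) makes y unique
   as a total function; the derivative condition at 0 also says that 0 is not a pole. *)
definition is_jacobi_sn :: "complex \<Rightarrow> (complex \<Rightarrow> complex) \<Rightarrow> bool" where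
  "is_jacobi_sn \<kappa> y \<longleftrightarrow>
     y nicely_meromorphic_on UNIV \<and>
     (\<forall>u. \<not> is_pole y u \<longrightarrow> (deriv y u)\<^sup>2 = (1 - (y u)\<^sup>2) * (1 - \<kappa>\<^sup>2 * (y u)\<^sup>2)) \<and>
     y 0 = 0 \<and> (y has_field_derivative 1) (at 0)"

(* Off its poles this is the true value of a / sn (a t): where sn has a pole both sn and the
   quotient are 0 by the conventions y = 0 at poles and x / 0 = 0. *)
definition beta :: "(complex \<Rightarrow> complex) \<Rightarrow> complex \<Rightarrow> complex \<Rightarrow> complex" where
  "beta sn a t = a / sn (a * t)"

type_synonym vfun = "complex^3 \<Rightarrow> complex^3"

(* Holomorphy in three complex variables: the Frechet derivative exists and is complex-linear,
   i.e. given by a complex Jacobian matrix J. *)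
definition holomorphic3_on :: "vfun \<Rightarrow> (complex^3) set \<Rightarrow> bool"
    (infixl \<open>holomorphic3'_on\<close> 50) where
  "f holomorphic3_on U \<longleftrightarrow>
     (\<forall>t\<in>U. \<exists>J :: complex^3^3. (f has_derivative (\<lambda>v. J *v v)) (at t))"

definition partial :: "3 \<Rightarrow> vfun \<Rightarrow> vfun" where
  "partial i f t = (\<chi> m. deriv (\<lambda>z. f (\<chi> j. if j = i then z else t $ j) $ m) (t $ i))"

definition P1 :: "vfun \<Rightarrow> vfun" where
  "P1 f t = partial 1 f t + partial 2 f t + partial 3 f t"

definition P2_matrix :: "(complex \<Rightarrow> complex) \<Rightarrow> complex^3 \<Rightarrow> complex^3^3" where
  "P2_matrix \<beta> t =
    (let t12 = t $ 1 - t $ 2; t13 = t $ 1 - t $ 3; t23 = t $ 2 - t $ 3; \<beta>' = deriv \<beta> in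
     vector [vector [(\<beta> t12)\<^sup>2 + (\<beta> t13)\<^sup>2, \<beta>' t12, \<beta>' t13],
             vector [\<beta>' t12, (\<beta> t12)\<^sup>2 + (\<beta> t23)\<^sup>2, \<beta>' t23],
             vector [\<beta>' t13, \<beta>' t23, (\<beta> t23)\<^sup>2 + (\<beta> t13)\<^sup>2]])"

definition P2 :: "complex \<Rightarrow> (complex \<Rightarrow> complex) \<Rightarrow> vfun \<Rightarrow> vfun" where
  "P2 k \<beta> f t =
     partial 1 (partial 2 f) t + partial 2 (partial 3 f) t + partial 3 (partial 1 f) t
     + (k * (k - 1) * ((\<beta> (t $ 1 - t $ 2))\<^sup>2 + (\<beta> (t $ 1 - t $ 3))\<^sup>2 + (\<beta> (t $ 2 - t $ 3))\<^sup>2)) *s f t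
     + k *s (P2_matrix \<beta> t *v f t)"

definition Q1_matrix :: "(complex \<Rightarrow> complex) \<Rightarrow> complex^3 \<Rightarrow> complex^3^3" where
  "Q1_matrix \<beta> t =
    (let t12 = t $ 1 - t $ 2; t13 = t $ 1 - t $ 3; t23 = t $ 2 - t $ 3 in
     vector [vector [0, - \<beta> t12, - \<beta> t13],
             vector [\<beta> t12, 0, - \<beta> t23],
             vector [\<beta> t13, \<beta> t23, 0]])"

definition Q1 :: "complex \<Rightarrow> (complex \<Rightarrow> complex) \<Rightarrow> vfun \<Rightarrow> vfun" where
  "Q1 k \<beta> f t = (\<chi> i. partial i f t $ i) + k *s (Q1_matrix \<beta> t *v f t)"

definition regular_set :: "(complex \<Rightarrow> complex) \<Rightarrow> (complex^3) set" where
  "regular_set \<beta> = {t. \<forall>i j. i \<noteq> j \<longrightarrow> \<not> is_pole \<beta> (t $ i - t $ j)}"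

(* Equality of the two compositions as differential operators with coefficients holomorphic on D:
   they agree on every holomorphic function on every open subset of D. *)
definition commute_on ::
    "(complex^3) set \<Rightarrow> (vfun \<Rightarrow> vfun) \<Rightarrow> (vfun \<Rightarrow> vfun) \<Rightarrow> bool" where
  "commute_on D A B \<longleftrightarrow>
     (\<forall>U f. open U \<and> U \<subseteq> D \<and> f holomorphic3_on U \<longrightarrow> (\<forall>t\<in>U. A (B f) t = B (A f) t))"

end

theory Submission
  imports Defs
begin

text \<open>
  Write b i j for \<beta>(t_i - t_j), d i j for \<beta>'(t_i - t_j), E for the second elementary symmetric
  polynomial in the three partial derivatives, D for their diagonal matrix, V for the sum of the
  b i j squared over i < j, and P2 = E + k(k-1)V + kM, Q1 = D + kN. All coefficients depend on
  differences of the variables only, so they are annihilated by P1; hence P1 commutes with P2 and Q1.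

  For P2 and Q1 the commutator is sorted by powers of the derivatives. Here \<beta> is odd, so
  N i j = - b i j for all i \<noteq> j and M i j = d i j is symmetric.
  In the off-diagonal entry (i,j), the contribution of [E, kN] is
  k(\<beta>'' + \<beta>'(\<partial>_i - \<partial>_j)), and [kM, D] contributes the negative of this.
  On the diagonal, [kM, D] and k(k-1)[V, D] differentiate the squares, and their sum
  -2 k^2 (b i j d i j + b i n d i n) is compensated by k^2 [M, N].
  The off-diagonal entries of k^2 [M, N] remain; with x = t_i - t_n and y = t_n - t_j the entry (i,j)
  vanishes if and only if
    \<beta>(x) \<beta>'(y) - \<beta>'(x) \<beta>(y) = \<beta>(x + y) (\<beta>(x)^2 - \<beta>(y)^2).
  This is the addition theorem of sn, written for its reciprocal.

  The addition theorem follows from the differential equations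
  \<beta>'^2 = \<beta>^4 + C \<beta>^2 + A and \<beta>'' = 2 \<beta>^3 + C \<beta>. For fixed c = x + y they imply
  that the quotient of the left-hand side by \<beta>(x)^2 - \<beta>(c - x)^2 has derivative 0 with respect
  to x, and its limit at the pole x = 0 is \<beta>(c) (addition_near_0). This is shown near 0 and
  extends to all x by the identity theorem for meromorphic functions (meromorphic_identity). The
  same theorem spreads the differential equations and the oddness of \<beta> from a neighbourhood of 0.

  The compositions of the operators involve derivatives up to order three, whereas holomorphy in
  three variables only supplies a first derivative. Cauchy's integral formula in one variable,
  differentiated under the integral sign, shows that partial derivatives of holomorphic functions
  are holomorphic (holo_on_pd) and that they commute (pd_commute); after that the calculation with
  the operators is formal.
\<close>

no_notation fps_nth (infixl "$" 75)

section \<open>Partial derivatives of holomorphic functions of several variables\<close>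

text \<open>
  The scalar counterpart of holomorphic3_on, in any finite dimension: the matrix operators are
  studied component by component.
\<close>
definition holo_on :: "(complex^'n \<Rightarrow> complex) \<Rightarrow> (complex^'n) set \<Rightarrow> bool" where
  "holo_on g U \<longleftrightarrow>
     (\<forall>t\<in>U. \<exists>J :: complex^'n. (g has_derivative (\<lambda>v. \<Sum>j\<in>UNIV. J $ j * v $ j)) (at t))"

definition pd :: "'n::finite \<Rightarrow> (complex^'n \<Rightarrow> complex) \<Rightarrow> complex^'n \<Rightarrow> complex" where
  "pd i g t = deriv (\<lambda>z. g (\<chi> j. if j = i then z else t $ j)) (t $ i)"

lemma line_eq_axis:
  fixes t :: "complex^'n::finite"
  shows "(\<chi> j. if j = i then z else t $ j) = t + axis i (z - t $ i)"
  by (simp add: vec_eq_iff axis_def)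

lemma bounded_linear_axis: "bounded_linear (axis i :: complex \<Rightarrow> complex^'n::finite)"
proof -
  have "linear (axis i :: complex \<Rightarrow> complex^'n)"
    by (auto intro!: linearI simp: axis_def vec_eq_iff)
  then show ?thesis by (simp add: linear_conv_bounded_linear)
qed

lemma axis_zero: "axis i (0 :: complex) = (0 :: complex^'n::finite)"
  by (simp add: axis_def vec_eq_iff)

lemma norm_axis_complex: "norm (axis i w :: complex^'n::finite) = norm w"
  by (simp add: norm_vec_def L2_set_def axis_def if_distrib[of norm] if_distrib[of "\<lambda>x. x\<^sup>2"] cong: if_cong)

lemma slice_derivative:
  fixes g :: "complex^'n::finite \<Rightarrow> complex"
  assumes "(g has_derivative (\<lambda>v. \<Sum>j\<in>UNIV. J $ j * v $ j)) (at (t + axis i (z - c)))"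
  shows "((\<lambda>z. g (t + axis i (z - c))) has_field_derivative J $ i) (at z)"
proof -
  have "((\<lambda>z. t + axis i (z - c)) has_derivative (\<lambda>h. axis i h)) (at z)"
    by (auto intro!: derivative_eq_intros bounded_linear.has_derivative[OF bounded_linear_axis])
  from has_derivative_compose[OF this assms]
  have "((\<lambda>z. g (t + axis i (z - c))) has_derivative (\<lambda>h. \<Sum>j\<in>UNIV. J $ j * axis i h $ j)) (at z)" .
  moreover have "(\<lambda>h. \<Sum>j\<in>UNIV. J $ j * axis i h $ j) = (*) (J $ i)"
    by (simp add: axis_def if_distrib sum.delta' cong: if_cong)
  ultimately show ?thesis by (simp add: has_field_derivative_def)
qed

lemma pd_eq: "pd i g t = deriv (\<lambda>z. g (t + axis i (z - t $ i))) (t $ i)"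
  by (simp add: pd_def line_eq_axis)

lemma holo_on_imp_has_derivative:
  assumes "holo_on g U" "t \<in> U"
  shows "(g has_derivative (\<lambda>v. \<Sum>j\<in>UNIV. pd j g t * v $ j)) (at t)"
proof -
  obtain J where J: "(g has_derivative (\<lambda>v. \<Sum>j\<in>UNIV. J $ j * v $ j)) (at t)"
    using assms by (auto simp: holo_on_def)
  have "pd i g t = J $ i" for i
    unfolding pd_eq by (rule DERIV_imp_deriv, rule slice_derivative) (use J in \<open>simp add: axis_zero\<close>)
  with J show ?thesis by simp
qed

lemma holo_on_slice:
  assumes "holo_on g U" "t + axis i (z - c) \<in> U"
  shows "((\<lambda>z. g (t + axis i (z - c))) has_field_derivative pd i g (t + axis i (z - c))) (at z)"
proof -
  have "(g has_derivative (\<lambda>v. \<Sum>j\<in>UNIV. (\<chi> j. pd j g (t + axis i (z - c))) $ j * v $ j))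
        (at (t + axis i (z - c)))"
    using holo_on_imp_has_derivative[OF assms] by simp
  from slice_derivative[OF this] show ?thesis by simp
qed

lemma pd_unique:
  assumes "(g has_derivative (\<lambda>v. \<Sum>j\<in>UNIV. J $ j * v $ j)) (at t)"
  shows "pd i g t = J $ i"
  unfolding pd_eq
  by (rule DERIV_imp_deriv, rule slice_derivative) (use assms in \<open>simp add: axis_zero\<close>)

lemma holo_on_continuous: "holo_on g U \<Longrightarrow> continuous_on U g"
  by (meson continuous_at_imp_continuous_on has_derivative_continuous holo_on_imp_has_derivative)

text \<open>
  The Cauchy formula for the derivative along the i-th coordinate line. Parametrizing the circle by
  r cis(2 \<pi> s) leaves an integral over a fixed interval whose integrand depends on t only through
  a translated argument of g, so that continuity and differentiability in t pass to the integral.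
\<close>
lemma pd_Cauchy:
  fixes g :: "complex^'n::finite \<Rightarrow> complex"
  assumes g: "holo_on g U" and r: "r > 0" and disc: "\<And>w. norm w \<le> r \<Longrightarrow> t + axis i w \<in> U"
  shows "pd i g t = integral {0..1} (\<lambda>s. g (t + axis i (r * cis (2 * pi * s))) / (r * cis (2 * pi * s)))"
proof -
  define h where "h = (\<lambda>z. g (t + axis i (z - t $ i)))"
  have der: "(h has_field_derivative pd i g (t + axis i (z - t $ i))) (at z)" if "z \<in> cball (t $ i) r" for z
    unfolding h_def
    by (rule holo_on_slice[OF g], rule disc) (use that in \<open>simp add: dist_norm norm_minus_commute\<close>)
  have "h holomorphic_on cball (t $ i) r"
    unfolding holomorphic_on_def field_differentiable_def
    using der has_field_derivative_at_within by blast
  then have C: "contour_integral (circlepath (t $ i) r) (\<lambda>u. h u/(u - t $ i)^2) = 2 * pi * \<i> * deriv h (t $ i)"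
    using r by (intro Cauchy_contour_integral_circlepath_2)
      (auto intro: holomorphic_on_imp_continuous_on holomorphic_on_subset[OF _ ball_subset_cball])
  have "contour_integral (circlepath (t $ i) r) (\<lambda>u. h u/(u - t $ i)^2)
      = integral {0..1} (\<lambda>s. 2 * pi * \<i> * (g (t + axis i (r * cis (2 * pi * s))) / (r * cis (2 * pi * s))))"
    unfolding contour_integral_integral
  proof (rule integral_cong)
    fix s :: real
    show "h (circlepath (t $ i) r s) / (circlepath (t $ i) r s - t $ i)\<^sup>2 *
        vector_derivative (circlepath (t $ i) r) (at s) =
      2 * pi * \<i> * (g (t + axis i (r * cis (2 * pi * s))) / (r * cis (2 * pi * s)))"
      unfolding vector_derivative_circlepath
      using r by (simp add: h_def circlepath cis_conv_exp power2_eq_square mult_ac)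
  qed
  also have "\<dots> = 2 * pi * \<i> * integral {0..1} (\<lambda>s. g (t + axis i (r * cis (2 * pi * s))) / (r * cis (2 * pi * s)))"
    by (rule integral_mult_right)
  finally have "2 * pi * \<i> * deriv h (t $ i) = 2 * pi * \<i> * integral {0..1} (\<lambda>s. g (t + axis i (r * cis (2 * pi * s))) / (r * cis (2 * pi * s)))"
    using C by simp
  then show ?thesis by (simp add: pd_eq h_def)
qed

text \<open>
  Near a point of an open set, one radius serves for the Cauchy formula at all base points and along
  all coordinate directions.
\<close>
lemma uniform_axis_discs:
  assumes "open U" "(t0 :: complex^'n::finite) \<in> U"
  shows "\<exists>r>0. \<forall>t\<in>ball t0 r. \<forall>i w. norm w \<le> r \<longrightarrow> t + axis i w \<in> U"
proof -
  obtain e where e: "e > 0" "ball t0 e \<subseteq> U" using assms open_contains_ball by blast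
  have "t + axis i w \<in> U" if "t \<in> ball t0 (e/2)" "norm w \<le> e/2" for t i w
  proof -
    have "norm (axis i w :: complex^'n) \<le> e/2" using that by (simp add: norm_axis_complex)
    moreover have "dist t0 (t + axis i w) \<le> dist t0 t + norm (axis i w :: complex^'n)"
      using dist_triangle[of t0 "t + axis i w" t] by (simp add: dist_norm)
    ultimately have "t + axis i w \<in> ball t0 e" using that by simp
    then show ?thesis using e by blast
  qed
  then show ?thesis using e(1) by (intro exI[of _ "e/2"]) auto
qed

lemma continuous_on_circle_shift:
  assumes "continuous_on U g" "\<And>t w. t \<in> V \<Longrightarrow> norm w \<le> r \<Longrightarrow> t + axis i w \<in> (U :: (complex^'n::finite) set)" "r > 0"
  shows "continuous_on (V \<times> cbox 0 1) (\<lambda>(t, s::real). g (t + axis i (r * cis (2 * pi * s))) / (r * cis (2 * pi * s)) :: complex)"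
proof -
  have "continuous_on (V \<times> cbox 0 1) (\<lambda>x. axis i (r * cis (2 * pi * snd x)) :: complex^'n)"
    by (rule bounded_linear.continuous_on[OF bounded_linear_axis]) (auto intro!: continuous_intros)
  then have "continuous_on (V \<times> cbox 0 1) (\<lambda>x. g (fst x + axis i (r * cis (2 * pi * snd x))))"
    by (intro continuous_on_compose2[OF assms(1)])
      (auto intro!: continuous_intros assms(2) simp: norm_mult less_imp_le assms(3))
  then show ?thesis using assms(3)
    by (auto simp: case_prod_unfold intro!: continuous_intros)
qed

lemma continuous_on_pd:
  assumes "open U" "holo_on g U"
  shows "continuous_on U (pd i g)"
proof -
  have "isCont (pd i g) t0" if t0: "t0 \<in> U" for t0
  proof -
    obtain r where r: "r > 0" and d: "\<forall>t\<in>ball t0 r. \<forall>i w. norm w \<le> r \<longrightarrow> t + axis i w \<in> U"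
      using uniform_axis_discs[OF assms(1) t0] by blast
    have cont: "continuous_on (ball t0 r) (\<lambda>t. integral (cbox 0 1) (\<lambda>s. g (t + axis i (r * cis (2 * pi * s))) / (r * cis (2 * pi * s))))"
      by (rule integral_continuous_on_param)
        (use continuous_on_circle_shift[OF holo_on_continuous[OF assms(2)], of "ball t0 r" r] d r in auto)
    have eq: "integral (cbox 0 1) (\<lambda>s. g (t + axis i (r * cis (2 * pi * s))) / (r * cis (2 * pi * s))) = pd i g t"
      if "t \<in> ball t0 r" for t
      using pd_Cauchy[OF assms(2) r] d that by simp
    have "continuous_on (ball t0 r) (pd i g)" by (rule continuous_on_eq[OF cont eq])
    then show ?thesis using r by (simp add: continuous_on_eq_continuous_at)
  qed
  then show ?thesis by (simp add: continuous_at_imp_continuous_on)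
qed

text \<open>
  Differentiation under the integral sign in the Cauchy formula. The entries J $ j are the Cauchy
  integrals of the functions pd j g along the i-th axis. Those functions are not yet known to be
  holomorphic, which is why the integrals are not written as second derivatives here.
\<close>
lemma pd_has_derivative:
  fixes g :: "complex^'n::finite \<Rightarrow> complex"
  assumes U: "open U" and g: "holo_on g U" and t0: "t0 \<in> U"
  obtains r J where "r > 0" "\<And>w. norm w \<le> r \<Longrightarrow> t0 + axis i w \<in> U"
    "(pd i g has_derivative (\<lambda>v. \<Sum>j\<in>UNIV. J $ j * v $ j)) (at t0)"
    "\<And>j. J $ j = integral {0..1} (\<lambda>s. pd j g (t0 + axis i (r * cis (2 * pi * s))) / (r * cis (2 * pi * s)))"
proof -
  obtain r where r: "r > 0" and d: "\<forall>t\<in>ball t0 r. \<forall>i w. norm w \<le> r \<longrightarrow> t + axis i w \<in> U"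
    using uniform_axis_discs[OF U t0] by blast
  define \<rho> where "\<rho> = (\<lambda>s::real. of_real r * cis (2 * pi * s))"
  have \<rho>: "norm (\<rho> s) \<le> r" "\<rho> s \<noteq> 0" for s
    using r by (auto simp: \<rho>_def norm_mult)
  define D where "D = (\<lambda>t s. Blinfun (\<lambda>v :: complex^'n. \<Sum>j\<in>UNIV. pd j g (t + axis i (\<rho> s)) / \<rho> s * v $ j))"
  have D: "blinfun_apply (D t s) = (\<lambda>v. \<Sum>j\<in>UNIV. pd j g (t + axis i (\<rho> s)) / \<rho> s * v $ j)" for t s
    unfolding D_def
    by (rule bounded_linear_Blinfun_apply)
      (intro bounded_linear_sum bounded_linear_const_mult bounded_linear_vec_nth)
  have der: "((\<lambda>t. g (t + axis i (\<rho> s)) / \<rho> s) has_derivative blinfun_apply (D t s)) (at t within ball t0 r)"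
    if "t \<in> ball t0 r" for t s
  proof -
    have "((\<lambda>t. t + axis i (\<rho> s)) has_derivative (\<lambda>v. v)) (at t)"
      by (auto intro!: derivative_eq_intros)
    from has_derivative_compose[OF this holo_on_imp_has_derivative[OF g d[rule_format, OF that \<rho>(1)]]]
    have "((\<lambda>t. g (t + axis i (\<rho> s))) has_derivative (\<lambda>v. \<Sum>j\<in>UNIV. pd j g (t + axis i (\<rho> s)) * v $ j)) (at t)" .
    from has_derivative_mult_left[OF this, of "inverse (\<rho> s)"]
    have "((\<lambda>t. g (t + axis i (\<rho> s)) / \<rho> s) has_derivative blinfun_apply (D t s)) (at t)"
      by (simp add: D sum_distrib_right sum_distrib_left divide_inverse mult_ac)
    then show ?thesis by (rule has_derivative_at_withinI)
  qed
  have cont: "continuous_on (ball t0 r \<times> cbox 0 1) (\<lambda>(t, s). h (t + axis i (\<rho> s)) / \<rho> s)"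
    if "continuous_on U h" for h
    using continuous_on_circle_shift[OF that, of "ball t0 r" r i] d r by (simp add: \<rho>_def)
  \<comment> \<open>Leibniz' rule needs the full derivative to be continuous as an operator; it is a
      combination of the partial derivatives, whose continuity is a consequence of the Cauchy formula.\<close>
  have contD: "continuous_on (ball t0 r \<times> cbox 0 1) (\<lambda>(t, s). D t s)"
  proof (rule continuous_on_blinfun_componentwise)
    fix b :: "complex^'n"
    have "continuous_on (ball t0 r \<times> cbox 0 1) (\<lambda>x. \<Sum>j\<in>UNIV. (case x of (t, s) \<Rightarrow> pd j g (t + axis i (\<rho> s)) / \<rho> s) * b $ j)"
      by (intro continuous_intros cont continuous_on_pd[OF U g])
    then show "continuous_on (ball t0 r \<times> cbox 0 1) (\<lambda>x. blinfun_apply (case x of (t, s) \<Rightarrow> D t s) b)"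
      by (simp add: case_prod_unfold D)
  qed
  have slice: "continuous_on (cbox 0 1) (\<lambda>s. F t s)"
    if "continuous_on (ball t0 r \<times> cbox 0 1) (\<lambda>(t, s). F t s)" "t \<in> ball t0 r" for F :: "complex^'n \<Rightarrow> real \<Rightarrow> 'c::topological_space" and t
  proof -
    have "continuous_on (cbox 0 1) (\<lambda>s::real. (t, s))"
      by (intro continuous_on_Pair continuous_on_const continuous_on_id)
    moreover have "(\<lambda>s. (t, s)) ` cbox 0 1 \<subseteq> ball t0 r \<times> cbox 0 (1::real)" using that(2) by auto
    ultimately show ?thesis using continuous_on_compose2[OF that(1)] by force
  qed
  have mem: "t0 \<in> ball t0 r" using r by simp
  have leib: "((\<lambda>t. integral (cbox 0 1) (\<lambda>s. g (t + axis i (\<rho> s)) / \<rho> s)) has_derivative integral (cbox 0 1) (D t0)) (at t0 within ball t0 r)"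
  proof (rule leibniz_rule[OF der _ contD mem convex_ball])
    fix t assume "t \<in> ball t0 r"
    then show "(\<lambda>s. g (t + axis i (\<rho> s)) / \<rho> s) integrable_on cbox 0 1"
      by (rule integrable_continuous[OF slice[OF cont[OF holo_on_continuous[OF g]]]])
  qed
  have Cauchy: "integral (cbox 0 1) (\<lambda>s. g (t + axis i (\<rho> s)) / \<rho> s) = pd i g t" if "t \<in> ball t0 r" for t
    using pd_Cauchy[OF g r] d that by (simp add: \<rho>_def)
  have 1: "(pd i g has_derivative integral (cbox 0 1) (D t0)) (at t0)"
    using has_derivative_transform_within_open[OF leib[unfolded at_within_open[OF mem open_ball]] open_ball mem Cauchy] .
  have int: "(\<lambda>s. pd j g (t0 + axis i (\<rho> s)) / \<rho> s) integrable_on cbox 0 1" for j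
    by (rule integrable_continuous) (rule slice[OF cont[OF continuous_on_pd[OF U g]] mem])
  define J where "J = (\<chi> j. integral (cbox 0 1) (\<lambda>s. pd j g (t0 + axis i (\<rho> s)) / \<rho> s))"
  have "blinfun_apply (integral (cbox 0 1) (D t0)) v = (\<Sum>j\<in>UNIV. J $ j * v $ j)" for v
  proof -
    have "blinfun_apply (integral (cbox 0 1) (D t0)) v = integral (cbox 0 1) (\<lambda>s. blinfun_apply (D t0 s) v)"
      by (rule blinfun_apply_integral, rule integrable_continuous, rule slice[OF contD mem])
    also have "\<dots> = (\<Sum>j\<in>UNIV. integral (cbox 0 1) (\<lambda>s. pd j g (t0 + axis i (\<rho> s)) / \<rho> s * v $ j))"
      unfolding D by (rule integral_sum) (simp, rule integrable_on_mult_left[OF int])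
    finally show ?thesis by (simp only: integral_mult_left J_def vec_lambda_beta)
  qed
  then have "blinfun_apply (integral (cbox 0 1) (D t0)) = (\<lambda>v. \<Sum>j\<in>UNIV. J $ j * v $ j)" by (rule ext)
  with 1 have 2: "(pd i g has_derivative (\<lambda>v. \<Sum>j\<in>UNIV. J $ j * v $ j)) (at t0)"
    by (simp only:)
  have "J $ j = integral {0..1} (\<lambda>s. pd j g (t0 + axis i (r * cis (2 * pi * s))) / (r * cis (2 * pi * s)))" for j
    by (simp add: J_def \<rho>_def)
  with 2 show ?thesis
    using that[OF r] d mem by blast
qed

lemma holo_on_pd:
  assumes "open U" "holo_on g U"
  shows "holo_on (pd i g) U"
  unfolding holo_on_def
proof
  fix t assume "t \<in> U"
  then obtain r J where "(pd i g has_derivative (\<lambda>v. \<Sum>j\<in>UNIV. J $ j * v $ j)) (at t)"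
    by (rule pd_has_derivative[OF assms])
  then show "\<exists>J :: complex^'a. (pd i g has_derivative (\<lambda>v. \<Sum>j\<in>UNIV. J $ j * v $ j)) (at t)" by blast
qed

text \<open>
  Both sides are the same Cauchy integral of pd j g along the i-th axis: the left-hand side by
  differentiation under the integral sign, the right-hand side by the Cauchy formula for pd j g.
\<close>
lemma pd_commute:
  assumes U: "open U" and g: "holo_on g U" and t: "t \<in> U"
  shows "pd j (pd i g) t = pd i (pd j g) t"
proof (rule pd_has_derivative[OF assms])
  fix r :: real and J
  assume r: "r > 0" "\<And>w. norm w \<le> r \<Longrightarrow> t + axis i w \<in> U"
    and der: "(pd i g has_derivative (\<lambda>v. \<Sum>j\<in>UNIV. J $ j * v $ j)) (at t)"
    and J: "\<And>j. J $ j = integral {0..1} (\<lambda>s. pd j g (t + axis i (r * cis (2 * pi * s))) / (r * cis (2 * pi * s)))"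
  show ?thesis
    unfolding pd_unique[OF der] J by (rule pd_Cauchy[OF holo_on_pd[OF U g] r, symmetric])
qed

section \<open>Differentiation rules\<close>

lemma pd_cong:
  assumes U: "open U" "t \<in> U" and eq: "\<And>x. x \<in> U \<Longrightarrow> g x = h x"
  shows "pd i g t = pd i h t"
proof -
  have "continuous_on UNIV (\<lambda>z. t + axis i (z - t $ i))"
    by (intro continuous_intros bounded_linear.continuous_on[OF bounded_linear_axis])
  then have "open ((\<lambda>z. t + axis i (z - t $ i)) -` U)"
    by (rule open_vimage[OF U(1)])
  then have "\<forall>\<^sub>F z in nhds (t $ i). t + axis i (z - t $ i) \<in> U"
    using eventually_nhds_in_open[of "(\<lambda>z. t + axis i (z - t $ i)) -` U" "t $ i"] U(2) by (simp add: axis_zero)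
  then have "\<forall>\<^sub>F z in nhds (t $ i). g (t + axis i (z - t $ i)) = h (t + axis i (z - t $ i))"
    by eventually_elim (rule eq)
  then show ?thesis unfolding pd_eq by (rule deriv_cong_ev) simp
qed

text \<open>
  To differentiate a compound function is to exhibit the coefficients of its derivative; this gives
  holomorphy and the values of the partial derivatives at once.
\<close>
lemma holo_onI:
  assumes "\<And>t. t \<in> U \<Longrightarrow> (g has_derivative (\<lambda>v. \<Sum>j\<in>UNIV. J t j * v $ j)) (at t)"
  shows "holo_on g U" and "t \<in> U \<Longrightarrow> pd i g t = J t i"
proof -
  have J: "(g has_derivative (\<lambda>v. \<Sum>j\<in>UNIV. (\<chi> j. J t j) $ j * v $ j)) (at t)" if "t \<in> U" for t
    using assms[OF that] by simp
  then show "holo_on g U" unfolding holo_on_def by blast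
  show "pd i g t = J t i" if "t \<in> U" using pd_unique[OF J[OF that]] by simp
qed

lemma
  assumes "holo_on g U" "holo_on h U"
  shows holo_on_add: "holo_on (\<lambda>t. g t + h t) U"
    and pd_add: "t \<in> U \<Longrightarrow> pd i (\<lambda>t. g t + h t) t = pd i g t + pd i h t"
proof -
  have "((\<lambda>t. g t + h t) has_derivative (\<lambda>v. \<Sum>j\<in>UNIV. (pd j g t + pd j h t) * v $ j)) (at t)"
    if "t \<in> U" for t
    using has_derivative_add[OF assms[THEN holo_on_imp_has_derivative, OF that]]
    by (simp add: sum.distrib distrib_right)
  from holo_onI[OF this] show "holo_on (\<lambda>t. g t + h t) U"
    "t \<in> U \<Longrightarrow> pd i (\<lambda>t. g t + h t) t = pd i g t + pd i h t" by blast+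
qed

lemma
  assumes "holo_on g U" "holo_on h U"
  shows holo_on_mult: "holo_on (\<lambda>t. g t * h t) U"
    and pd_mult: "t \<in> U \<Longrightarrow> pd i (\<lambda>t. g t * h t) t = g t * pd i h t + pd i g t * h t"
proof -
  have "((\<lambda>t. g t * h t) has_derivative (\<lambda>v. \<Sum>j\<in>UNIV. (g t * pd j h t + pd j g t * h t) * v $ j)) (at t)"
    if "t \<in> U" for t
    using has_derivative_mult[OF assms[THEN holo_on_imp_has_derivative, OF that]]
    by (simp add: sum.distrib algebra_simps sum_distrib_left)
  from holo_onI[OF this] show "holo_on (\<lambda>t. g t * h t) U"
    "t \<in> U \<Longrightarrow> pd i (\<lambda>t. g t * h t) t = g t * pd i h t + pd i g t * h t" by blast+
qed

lemma
  shows holo_on_const: "holo_on (\<lambda>t. c) U"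
    and pd_const: "pd i (\<lambda>t. c) t = 0"
proof -
  have "((\<lambda>t. c) has_derivative (\<lambda>v. \<Sum>j\<in>UNIV. 0 * v $ j)) (at t)" for t :: "complex^'n::finite"
    by simp
  from holo_onI[of _ "\<lambda>t. c", OF this] show "holo_on (\<lambda>t. c) U" "pd i (\<lambda>t. c) t = 0" by blast+
qed

lemma
  assumes "holo_on g U"
  shows holo_on_cmult: "holo_on (\<lambda>t. c * g t) U"
    and pd_cmult: "t \<in> U \<Longrightarrow> pd i (\<lambda>t. c * g t) t = c * pd i g t"
  using holo_on_mult[OF holo_on_const assms] pd_mult[OF holo_on_const assms]
  by (simp_all add: pd_const)

lemma
  assumes an: "\<And>t. t \<in> U \<Longrightarrow> \<phi> analytic_on {t $ a - t $ b}"
  shows holo_on_difference: "holo_on (\<lambda>t. \<phi> (t $ a - t $ b)) U"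
    and pd_difference: "t \<in> U \<Longrightarrow> pd i (\<lambda>t. \<phi> (t $ a - t $ b)) t
            = (of_bool (i = a) - of_bool (i = b)) * deriv \<phi> (t $ a - t $ b)"
proof -
  have "((\<lambda>t. \<phi> (t $ a - t $ b)) has_derivative
      (\<lambda>v. \<Sum>j\<in>UNIV. ((of_bool (j = a) - of_bool (j = b)) * deriv \<phi> (t $ a - t $ b)) * v $ j)) (at t)"
    if "t \<in> U" for t
  proof -
    have "((\<lambda>t. t $ a - t $ b) has_derivative (\<lambda>v. v $ a - v $ b)) (at t)"
      by (intro has_derivative_diff bounded_linear.has_derivative[OF bounded_linear_vec_nth] has_derivative_ident)
    moreover have "(\<phi> has_derivative (*) (deriv \<phi> (t $ a - t $ b))) (at (t $ a - t $ b))"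
      using an[OF that] analytic_on_imp_differentiable_at field_differentiable_derivI
      unfolding has_field_derivative_def[symmetric] by blast
    ultimately have "((\<lambda>t. \<phi> (t $ a - t $ b)) has_derivative (\<lambda>v. deriv \<phi> (t $ a - t $ b) * (v $ a - v $ b))) (at t)"
      by (rule has_derivative_compose)
    moreover have "(\<Sum>j\<in>UNIV. ((of_bool (j = a) - of_bool (j = b)) * deriv \<phi> (t $ a - t $ b)) * v $ j)
        = deriv \<phi> (t $ a - t $ b) * (v $ a - v $ b)" for v
      by (simp add: of_bool_def left_diff_distrib right_diff_distrib sum_subtractf
          if_distrib[of "\<lambda>x. x * _"] if_distrib[of "\<lambda>x. _ * x"] mult_ac cong: if_cong)
    ultimately show ?thesis by simp
  qed
  from holo_onI[OF this] show "holo_on (\<lambda>t. \<phi> (t $ a - t $ b)) U"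
    "t \<in> U \<Longrightarrow> pd i (\<lambda>t. \<phi> (t $ a - t $ b)) t
            = (of_bool (i = a) - of_bool (i = b)) * deriv \<phi> (t $ a - t $ b)" by blast+
qed

lemma pd_pd_add:
  assumes "open U" "holo_on g U" "holo_on h U" "t \<in> U"
  shows "pd i (pd j (\<lambda>t. g t + h t)) t = pd i (pd j g) t + pd i (pd j h) t"
proof -
  have "pd i (pd j (\<lambda>t. g t + h t)) t = pd i (\<lambda>t. pd j g t + pd j h t) t"
    by (rule pd_cong[OF assms(1,4)]) (rule pd_add[OF assms(2,3)])
  also have "\<dots> = pd i (pd j g) t + pd i (pd j h) t"
    by (rule pd_add) (use assms holo_on_pd in blast)+
  finally show ?thesis .
qed

lemma pd_pd_cmult:
  assumes "open U" "holo_on g U" "t \<in> U"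
  shows "pd i (pd j (\<lambda>t. c * g t)) t = c * pd i (pd j g) t"
proof -
  have "pd i (pd j (\<lambda>t. c * g t)) t = pd i (\<lambda>t. c * pd j g t) t"
    by (rule pd_cong[OF assms(1,3)]) (rule pd_cmult[OF assms(2)])
  also have "\<dots> = c * pd i (pd j g) t"
    by (rule pd_cmult) (use assms holo_on_pd in blast)+
  finally show ?thesis .
qed

lemma pd_pd_mult:
  assumes "open U" "holo_on g U" "holo_on h U" "t \<in> U"
  shows "pd i (pd j (\<lambda>t. g t * h t)) t =
    g t * pd i (pd j h) t + pd i g t * pd j h t + pd j g t * pd i h t + pd i (pd j g) t * h t"
proof -
  note hol = holo_on_pd[OF assms(1)]
  have "pd i (pd j (\<lambda>t. g t * h t)) t = pd i (\<lambda>t. g t * pd j h t + pd j g t * h t) t"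
    by (rule pd_cong[OF assms(1,4)]) (rule pd_mult[OF assms(2,3)])
  also have "\<dots> = pd i (\<lambda>t. g t * pd j h t) t + pd i (\<lambda>t. pd j g t * h t) t"
    by (rule pd_add) (use assms in \<open>auto intro: holo_on_mult hol\<close>)
  also have "\<dots> = g t * pd i (pd j h) t + pd i g t * pd j h t + pd j g t * pd i h t + pd i (pd j g) t * h t"
    by (simp add: pd_mult[OF assms(2) hol[OF assms(3)] assms(4)] pd_mult[OF hol[OF assms(2)] assms(3,4)])
  finally show ?thesis .
qed

lemma pd_pd_difference:
  assumes "open U" "\<And>t. t \<in> U \<Longrightarrow> \<phi> analytic_on {t $ a - t $ b}" "t \<in> U"
  shows "pd i (pd j (\<lambda>t. \<phi> (t $ a - t $ b))) t =
    (of_bool (i = a) - of_bool (i = b)) * (of_bool (j = a) - of_bool (j = b)) * deriv (deriv \<phi>) (t $ a - t $ b)"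
proof -
  have an: "deriv \<phi> analytic_on {t $ a - t $ b}" if "t \<in> U" for t
    using assms(2)[OF that] by (rule analytic_deriv)
  have "pd i (pd j (\<lambda>t. \<phi> (t $ a - t $ b))) t
      = pd i (\<lambda>t. (of_bool (j = a) - of_bool (j = b)) * deriv \<phi> (t $ a - t $ b)) t"
    by (rule pd_cong[OF assms(1,3)]) (rule pd_difference[OF assms(2)])
  also have "\<dots> = (of_bool (j = a) - of_bool (j = b)) * pd i (\<lambda>t. deriv \<phi> (t $ a - t $ b)) t"
    by (rule pd_cmult[OF holo_on_difference]) (use an assms in auto)
  also have "pd i (\<lambda>t. deriv \<phi> (t $ a - t $ b)) t = (of_bool (i = a) - of_bool (i = b)) * deriv (deriv \<phi>) (t $ a - t $ b)"
    by (rule pd_difference) (use an assms in auto)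
  finally show ?thesis by (simp add: mult_ac)
qed

lemma partial_nth: "partial i f t $ m = pd i (\<lambda>t. f t $ m) t"
  by (simp add: partial_def pd_def)

lemma holomorphic3_on_component:
  assumes "f holomorphic3_on U"
  shows "holo_on (\<lambda>t. f t $ m) U"
proof (rule holo_onI)
  fix t assume "t \<in> U"
  then obtain J :: "complex^3^3" where "(f has_derivative (\<lambda>v. J *v v)) (at t)"
    using assms unfolding holomorphic3_on_def by blast
  then have "\<exists>J :: complex^3^3. (f has_derivative (\<lambda>v. J *v v)) (at t)" by blast
  \<comment> \<open>The Jacobian must be given as a function of the point, hence the choice operator.\<close>
  from someI_ex[OF this] show "((\<lambda>t. f t $ m) has_derivative
    (\<lambda>v. \<Sum>j\<in>UNIV. (SOME J. (f has_derivative (\<lambda>v. J *v v)) (at t)) $ m $ j * v $ j)) (at t)"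
    using bounded_linear.has_derivative[OF bounded_linear_vec_nth, of f _ _ m]
    by (fastforce simp: matrix_vector_mult_def)
qed

section \<open>The addition formula for the reciprocal of sn\<close>

text \<open>
  The identity theorem in the form used to propagate relations from a punctured neighbourhood of 0:
  zeros of a meromorphic function on the plane that accumulate somewhere force it to vanish
  wherever it is analytic.
\<close>
lemma meromorphic_identity:
  assumes F: "F meromorphic_on UNIV" and freq: "\<forall>\<^sub>F z in at w. F z = 0" and an: "F analytic_on {z}"
  shows "F z = 0"
proof -
  have "\<not> (\<forall>\<^sub>F z in cosparse UNIV. F z \<noteq> 0)"
  proof
    assume "\<forall>\<^sub>F z in cosparse UNIV. F z \<noteq> 0"
    then have "\<forall>\<^sub>F z in at w. F z \<noteq> 0" by (rule eventually_cosparse_imp_eventually_at) simp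
    with freq have "\<forall>\<^sub>F z in at w. False" by eventually_elim simp
    then show False by simp
  qed
  then have "\<forall>\<^sub>F z in cosparse UNIV. F z = 0"
    using meromorphic_imp_constant_or_avoid[OF F, of 0] by auto
  then have "\<forall>\<^sub>F z in at z. F z = 0" by (rule eventually_cosparse_imp_eventually_at) simp
  then have "F \<midarrow>z\<rightarrow> 0" by (rule tendsto_eventually)
  moreover have "F \<midarrow>z\<rightarrow> F z" using analytic_at_imp_isCont[OF an] by (simp add: isCont_def)
  ultimately show ?thesis using LIM_unique by blast
qed

lemma meromorphic_reflect: "f meromorphic_on UNIV \<Longrightarrow> (\<lambda>x. f (c - x)) meromorphic_on UNIV"
  by (erule meromorphic_on_compose[where f = "\<lambda>x. c - x"]) (intro analytic_intros, simp)

lemma analytic_reflect: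
  fixes f :: "complex \<Rightarrow> complex"
  assumes "f analytic_on {c - x}"
  shows "(\<lambda>x. f (c - x)) analytic_on {x}"
proof -
  have "(\<lambda>x. c - x) analytic_on {x}" by (intro analytic_intros)
  then show ?thesis
    using assms analytic_on_compose_gen[of "\<lambda>x. c - x" "{x}" f "{c - x}"] by (simp add: o_def)
qed

text \<open>
  What is needed of \<beta>(t) = a / sn(a t): it is meromorphic on the plane and, near 0, the reciprocal of
  a germ s = sn(a t) / a with s'^2 = 1 + C s^2 + A s^4. The condition on the real part of s' makes s'
  nonzero and prevents s'(x) + s'(-x) from vanishing, which is used as a denominator below.
\<close>
locale jacobi_reciprocal =
  fixes \<beta> s :: "complex \<Rightarrow> complex" and r :: real and A C :: complex
  assumes nicely: "\<beta> nicely_meromorphic_on UNIV"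
    and r: "r > 0"
    and holo: "s holomorphic_on ball 0 r"
    and s_0: "s 0 = 0" and s'_0: "deriv s 0 = 1"
    and s'_Re: "x \<in> ball 0 r \<Longrightarrow> Re (deriv s x) > 0"
    and s'_sq: "x \<in> ball 0 r \<Longrightarrow> (deriv s x)\<^sup>2 = 1 + C * (s x)\<^sup>2 + A * (s x)^4"
    and s_nz: "x \<in> ball 0 r \<Longrightarrow> x \<noteq> 0 \<Longrightarrow> s x \<noteq> 0"
    and \<beta>_s: "x \<in> ball 0 r \<Longrightarrow> x \<noteq> 0 \<Longrightarrow> \<beta> x = 1 / s x"
begin

lemma mero: "\<beta> meromorphic_on UNIV"
  using nicely by (simp add: nicely_meromorphic_on_def)

lemma s_deriv: "x \<in> ball 0 r \<Longrightarrow> (s has_field_derivative deriv s x) (at x)"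
  by (rule holomorphic_derivI[OF holo open_ball])

lemma s'_nz: "x \<in> ball 0 r \<Longrightarrow> deriv s x \<noteq> 0"
  using s'_Re[of x] by auto

text \<open>
  Differentiating s'^2 = 1 + C s^2 + A s^4 and cancelling 2 s'.
\<close>
lemma s'_deriv:
  assumes "x \<in> ball 0 r"
  shows "(deriv s has_field_derivative C * s x + 2 * A * (s x)^3) (at x)"
proof -
  have D: "(deriv s has_field_derivative deriv (deriv s) x) (at x)" if "x \<in> ball 0 r" for x
    by (rule holomorphic_derivI[OF holomorphic_deriv[OF holo open_ball] open_ball that])
  have "((\<lambda>x. (deriv s x)\<^sup>2) has_field_derivative 2 * deriv s x * deriv (deriv s) x) (at x)"
    using D[OF assms] by (auto intro!: derivative_eq_intros)
  moreover have "((\<lambda>x. (deriv s x)\<^sup>2) has_field_derivative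
      C * (2 * s x * deriv s x) + A * (4 * (s x)^3 * deriv s x)) (at x)"
  proof (rule has_field_derivative_transform_within_open[OF _ open_ball assms])
    show "((\<lambda>x. 1 + C * (s x)\<^sup>2 + A * (s x)^4) has_field_derivative
      C * (2 * s x * deriv s x) + A * (4 * (s x)^3 * deriv s x)) (at x)"
      using s_deriv[OF assms] by (auto intro!: derivative_eq_intros)
  qed (simp add: s'_sq)
  ultimately have "2 * deriv s x * deriv (deriv s) x = C * (2 * s x * deriv s x) + A * (4 * (s x)^3 * deriv s x)"
    by (rule DERIV_unique)
  also have "\<dots> = 2 * deriv s x * (C * s x + 2 * A * (s x)^3)"
    by (simp add: algebra_simps)
  finally have "deriv (deriv s) x = C * s x + 2 * A * (s x)^3"
    using s'_nz[OF assms] by simp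
  with D[OF assms] show ?thesis by simp
qed

text \<open>
  Uniqueness for the differential equation. Both s(x) and - s(-x) have the initial values of s;
  subtracting their first-order equations, which are quadratic in the derivatives, and dividing by
  s'(x) + s'(-x) shows that w(x) = s(x) + s(-x) satisfies a linear equation w' = q w with
  w(0) = 0, so w = 0.
\<close>
lemma s_odd:
  assumes "x \<in> ball 0 r"
  shows "s (- x) = - s x"
proof -
  define w where "w = (\<lambda>x. s x + s (- x))"
  define q where "q = (\<lambda>x. (s x - s (- x)) * (C + A * ((s x)\<^sup>2 + (s (- x))\<^sup>2)) / (deriv s x + deriv s (- x)))"
  have neg: "- x \<in> ball 0 r" if "x \<in> ball 0 r" for x :: complex
    using that by simp
  have nz: "deriv s x + deriv s (- x) \<noteq> 0" if "x \<in> ball 0 r" for x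
  proof -
    have "Re (deriv s x + deriv s (- x)) > 0"
      using s'_Re[OF that] s'_Re[OF neg[OF that]] by simp
    then show ?thesis by (metis less_irrefl zero_complex.sel(1))
  qed
  have holo_neg: "(\<lambda>x. f (- x)) holomorphic_on ball 0 r" if "f holomorphic_on ball 0 r" for f
  proof -
    have "uminus holomorphic_on ball 0 r" by (intro holomorphic_intros)
    moreover have "uminus ` ball 0 r \<subseteq> ball (0::complex) r" using neg by blast
    ultimately show ?thesis using holomorphic_on_compose_gen[OF _ that, of uminus] by (simp add: o_def)
  qed
  have "q holomorphic_on ball 0 r"
    unfolding q_def
    by (intro holomorphic_intros holo holo_neg holomorphic_deriv open_ball nz) auto
  then obtain Q where Q: "(Q has_field_derivative q x) (at x within ball 0 r)" if "x \<in> ball 0 r" for x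
    using holomorphic_convex_primitive'[OF convex_ball open_ball] by blast
  have w': "(w has_field_derivative q x * w x) (at x)" if "x \<in> ball 0 r" for x
  proof -
    have "((\<lambda>x. s (- x)) has_field_derivative - deriv s (- x)) (at x)"
      using DERIV_chain2[OF s_deriv[OF neg[OF that]] DERIV_minus[OF DERIV_ident]] by simp
    then have "(w has_field_derivative deriv s x - deriv s (- x)) (at x)"
      unfolding w_def using s_deriv[OF that] by (auto intro!: derivative_eq_intros)
    moreover have "(deriv s x - deriv s (- x)) * (deriv s x + deriv s (- x))
        = w x * (s x - s (- x)) * (C + A * ((s x)\<^sup>2 + (s (- x))\<^sup>2))"
      using s'_sq[OF that] s'_sq[OF neg[OF that]] unfolding w_def by algebra
    then have "deriv s x - deriv s (- x) = q x * w x"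
      using nz[OF that] by (simp add: q_def field_simps)
    ultimately show ?thesis by simp
  qed
  \<comment> \<open>The integrating factor exp(- Q) turns w' = q w into the statement that a product is constant.\<close>
  have "((\<lambda>x. w x * exp (- Q x)) has_field_derivative 0) (at x within ball 0 r)" if "x \<in> ball 0 r" for x
    using Q[OF that] has_field_derivative_at_within[OF w'[OF that]]
    by (auto intro!: derivative_eq_intros)
  then obtain c where c: "w x * exp (- Q x) = c" if "x \<in> ball 0 r" for x
    using has_field_derivative_zero_constant[OF convex_ball, of 0 r "\<lambda>x. w x * exp (- Q x)"] by blast
  have "w 0 * exp (- Q 0) = c" using r by (intro c) simp
  then have "c = 0" by (simp add: w_def s_0)
  with c[OF assms] have "w x = 0" by simp
  then show ?thesis by (simp add: w_def add_eq_0_iff)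
qed

lemma punctured_ball: "\<forall>\<^sub>F x in at 0. x \<in> ball 0 r \<and> (x::complex) \<noteq> 0"
  using r eventually_at_ball'[of r 0 UNIV] by (auto elim: eventually_mono)

lemma \<beta>_odd:
  assumes "\<beta> analytic_on {x}" "\<beta> analytic_on {- x}"
  shows "\<beta> (- x) = - \<beta> x"
proof -
  have "\<beta> x + \<beta> (0 - x) = 0"
  proof (rule meromorphic_identity[where w = 0 and F = "\<lambda>x. \<beta> x + \<beta> (0 - x)"])
    show "(\<lambda>x. \<beta> x + \<beta> (0 - x)) meromorphic_on UNIV"
      by (intro meromorphic_intros mero meromorphic_reflect)
    show "\<forall>\<^sub>F x in at 0. \<beta> x + \<beta> (0 - x) = 0"
      using punctured_ball by eventually_elim (use s_odd s_nz in \<open>auto simp: \<beta>_s\<close>)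
    show "(\<lambda>x. \<beta> x + \<beta> (0 - x)) analytic_on {x}"
      using assms by (intro analytic_intros analytic_reflect) auto
  qed
  then show ?thesis by (simp add: add_eq_0_iff)
qed

lemma \<beta>_deriv:
  assumes "x \<in> ball 0 r" "x \<noteq> 0"
  shows "deriv \<beta> x = - deriv s x / (s x)\<^sup>2"
proof (rule DERIV_imp_deriv)
  show "(\<beta> has_field_derivative - deriv s x / (s x)\<^sup>2) (at x)"
  proof (rule has_field_derivative_transform_within_open[where S = "ball 0 r - {0}"])
    show "((\<lambda>x. 1 / s x) has_field_derivative - deriv s x / (s x)\<^sup>2) (at x)"
      using s_deriv[OF assms(1)] s_nz[OF assms]
      by (auto intro!: derivative_eq_intros simp: power2_eq_square)
  qed (use assms \<beta>_s in \<open>auto simp: open_delete\<close>)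
qed

lemma \<beta>_deriv2:
  assumes "x \<in> ball 0 r" "x \<noteq> 0"
  shows "deriv (deriv \<beta>) x = 2 / (s x)^3 + C / s x"
proof (rule DERIV_imp_deriv)
  show "(deriv \<beta> has_field_derivative 2 / (s x)^3 + C / s x) (at x)"
  proof (rule has_field_derivative_transform_within_open[where S = "ball 0 r - {0}"])
    have "((\<lambda>x. - deriv s x / (s x)\<^sup>2) has_field_derivative
        (- (C * s x + 2 * A * (s x)^3) * (s x)\<^sup>2 - - deriv s x * (2 * s x * deriv s x)) / ((s x)\<^sup>2 * (s x)\<^sup>2)) (at x)"
    proof (rule DERIV_divide)
      show "((\<lambda>x. - deriv s x) has_field_derivative - (C * s x + 2 * A * (s x)^3)) (at x)"
        by (rule DERIV_minus[OF s'_deriv[OF assms(1)]])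
      show "((\<lambda>x. (s x)\<^sup>2) has_field_derivative 2 * s x * deriv s x) (at x)"
        using s_deriv[OF assms(1)] by (auto intro!: derivative_eq_intros)
      show "(s x)\<^sup>2 \<noteq> 0" using s_nz[OF assms] by simp
    qed
    moreover have "(- (C * s x + 2 * A * (s x)^3) * (s x)\<^sup>2 - - deriv s x * (2 * s x * deriv s x)) / ((s x)\<^sup>2 * (s x)\<^sup>2)
      = 2 / (s x)^3 + C / s x"
    proof -
      have "- (C * s x + 2 * A * (s x)^3) * (s x)\<^sup>2 - - deriv s x * (2 * s x * deriv s x) = 2 * s x + C * (s x)^3"
        using s'_sq[OF assms(1)] by algebra
      then show ?thesis using s_nz[OF assms] by (simp add: field_simps eval_nat_numeral)
    qed
    ultimately show "((\<lambda>x. - deriv s x / (s x)\<^sup>2) has_field_derivative 2 / (s x)^3 + C / s x) (at x)"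
      by simp
  qed (use assms \<beta>_deriv in \<open>auto simp: open_delete\<close>)
qed

lemma \<beta>_ode1:
  assumes "\<beta> analytic_on {z}"
  shows "(deriv \<beta> z)\<^sup>2 = (\<beta> z)^4 + C * (\<beta> z)\<^sup>2 + A"
proof -
  have "(deriv \<beta> z)\<^sup>2 - ((\<beta> z)^4 + C * (\<beta> z)\<^sup>2 + A) = 0"
  proof (rule meromorphic_identity[where w = 0 and F = "\<lambda>z. (deriv \<beta> z)\<^sup>2 - ((\<beta> z)^4 + C * (\<beta> z)\<^sup>2 + A)"])
    show "(\<lambda>z. (deriv \<beta> z)\<^sup>2 - ((\<beta> z)^4 + C * (\<beta> z)\<^sup>2 + A)) meromorphic_on UNIV"
      by (intro meromorphic_intros mero)
    show "\<forall>\<^sub>F z in at 0. (deriv \<beta> z)\<^sup>2 - ((\<beta> z)^4 + C * (\<beta> z)\<^sup>2 + A) = 0"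
      using punctured_ball
    proof eventually_elim
      case (elim x)
      then have x: "x \<in> ball 0 r" "x \<noteq> 0" by auto
      have "(deriv \<beta> x)\<^sup>2 = (deriv s x)\<^sup>2 / (s x)^4"
        unfolding \<beta>_deriv[OF x] by (simp add: power_divide flip: power_mult)
      then show ?case
        unfolding \<beta>_s[OF x] s'_sq[OF x(1)] using s_nz[OF x]
        by (simp add: field_simps eval_nat_numeral)
    qed
  qed (use assms in \<open>auto intro!: analytic_intros analytic_deriv\<close>)
  then show ?thesis by simp
qed

lemma \<beta>_ode2:
  assumes "\<beta> analytic_on {z}"
  shows "deriv (deriv \<beta>) z = 2 * (\<beta> z)^3 + C * \<beta> z"
proof -
  have "deriv (deriv \<beta>) z - (2 * (\<beta> z)^3 + C * \<beta> z) = 0"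
  proof (rule meromorphic_identity[where w = 0 and F = "\<lambda>z. deriv (deriv \<beta>) z - (2 * (\<beta> z)^3 + C * \<beta> z)"])
    show "(\<lambda>z. deriv (deriv \<beta>) z - (2 * (\<beta> z)^3 + C * \<beta> z)) meromorphic_on UNIV"
      by (intro meromorphic_intros mero)
    show "\<forall>\<^sub>F z in at 0. deriv (deriv \<beta>) z - (2 * (\<beta> z)^3 + C * \<beta> z) = 0"
      using punctured_ball
      by eventually_elim (use \<beta>_deriv2 \<beta>_s in \<open>auto simp: power_divide\<close>)
  qed (use assms in \<open>auto intro!: analytic_intros analytic_deriv\<close>)
  then show ?thesis by simp
qed

text \<open>
  The quotient from the overview, after multiplying numerator and denominator by s^2, is H / K with
  H and K analytic at 0 and K 0 = 1. The two differential equations give H' K = H K', so H / K is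
  constant on a ball around 0, with value \<beta> c at 0.
\<close>
lemma addition_near_0:
  assumes c: "\<beta> analytic_on {c}"
  shows "\<forall>\<^sub>F x in at 0. \<beta> x * deriv \<beta> (c - x) - deriv \<beta> x * \<beta> (c - x) = \<beta> c * ((\<beta> x)\<^sup>2 - (\<beta> (c - x))\<^sup>2)"
proof -
  obtain e where e: "e > 0" "\<beta> holomorphic_on ball c e"
    using c analytic_at_ball by blast
  define K where "K = (\<lambda>x. 1 - (s x)\<^sup>2 * (\<beta> (c - x))\<^sup>2)"
  define H where "H = (\<lambda>x. s x * deriv \<beta> (c - x) + deriv s x * \<beta> (c - x))"
  have an: "\<beta> analytic_on {c - x}" if "x \<in> ball 0 e" for x
    by (rule holomorphic_on_imp_analytic_at[OF e(2) open_ball]) (use that in \<open>simp add: dist_norm\<close>)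
  \<comment> \<open>The point c - x stays close to c, where \<beta> is analytic.\<close>
  have v: "((\<lambda>x. \<beta> (c - x)) has_field_derivative - deriv \<beta> (c - x)) (at x)"
    and v': "((\<lambda>x. deriv \<beta> (c - x)) has_field_derivative - deriv (deriv \<beta>) (c - x)) (at x)"
    if "x \<in> ball 0 e" for x
  proof -
    have refl: "((\<lambda>x. f (c - x)) has_field_derivative - deriv f (c - x)) (at x)" if "f analytic_on {c - x}" for f
    proof -
      have "((\<lambda>x. c - x) has_field_derivative - 1) (at x)" by (auto intro!: derivative_eq_intros)
      from DERIV_chain2[OF analytic_derivI[OF that] this] show ?thesis by simp
    qed
    show "((\<lambda>x. \<beta> (c - x)) has_field_derivative - deriv \<beta> (c - x)) (at x)"
      "((\<lambda>x. deriv \<beta> (c - x)) has_field_derivative - deriv (deriv \<beta>) (c - x)) (at x)"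
      using an[OF that] by (auto intro!: refl analytic_deriv)
  qed
  have "isCont K 0"
    unfolding K_def
    using DERIV_isCont[OF v[of 0]] DERIV_isCont[OF s_deriv[of 0]] e(1) r by (intro continuous_intros) auto
  moreover have "K 0 \<noteq> 0" by (simp add: K_def s_0)
  ultimately have "\<forall>\<^sub>F x in nhds 0. K x \<noteq> 0"
    by (intro tendsto_imp_eventually_ne[where c = "K 0"]) (auto simp: isCont_def tendsto_at_iff_tendsto_nhds)
  then obtain d where d: "d > 0" "\<And>x. x \<in> ball 0 d \<Longrightarrow> K x \<noteq> 0"
    unfolding eventually_nhds_metric by (auto simp: dist_commute)
  define \<rho> where "\<rho> = min r (min e d)"
  have \<rho>: "\<rho> > 0" "ball 0 \<rho> \<subseteq> ball 0 r" "ball 0 \<rho> \<subseteq> ball 0 e" "ball 0 \<rho> \<subseteq> ball 0 d"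
    using r e(1) d(1) by (auto simp: \<rho>_def)
  have "((\<lambda>x. H x / K x) has_field_derivative 0) (at x within ball 0 \<rho>)" if "x \<in> ball 0 \<rho>" for x
  proof -
    have x: "x \<in> ball 0 r" "x \<in> ball 0 e" "x \<in> ball 0 d" using that \<rho> by blast+
    note derivs = s_deriv[OF x(1)] s'_deriv[OF x(1)] v[OF x(2)] v'[OF x(2)]
    have H': "(H has_field_derivative (C * s x + 2 * A * (s x)^3) * \<beta> (c - x) - s x * (2 * (\<beta> (c - x))^3 + C * \<beta> (c - x))) (at x)"
      unfolding H_def using derivs \<beta>_ode2[OF an[OF x(2)]]
      by (auto intro!: derivative_eq_intros simp: algebra_simps)
    have K': "(K has_field_derivative - (2 * s x * deriv s x * (\<beta> (c - x))\<^sup>2) + 2 * (s x)\<^sup>2 * \<beta> (c - x) * deriv \<beta> (c - x)) (at x)"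
      unfolding K_def using derivs by (auto intro!: derivative_eq_intros simp: algebra_simps)
    have "((C * s x + 2 * A * (s x)^3) * \<beta> (c - x) - s x * (2 * (\<beta> (c - x))^3 + C * \<beta> (c - x))) * K x
      = H x * (- (2 * s x * deriv s x * (\<beta> (c - x))\<^sup>2) + 2 * (s x)\<^sup>2 * \<beta> (c - x) * deriv \<beta> (c - x))"
      using s'_sq[OF x(1)] \<beta>_ode1[OF an[OF x(2)]] unfolding H_def K_def by algebra
    then have "((\<lambda>x. H x / K x) has_field_derivative 0) (at x)"
      using DERIV_divide[OF H' K' d(2)[OF x(3)]] by simp
    then show ?thesis by (rule has_field_derivative_at_within)
  qed
  then obtain g where g: "H x / K x = g" if "x \<in> ball 0 \<rho>" for x
    using has_field_derivative_zero_constant[OF convex_ball, of 0 \<rho> "\<lambda>x. H x / K x"] by blast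
  have "H 0 / K 0 = g" using \<rho>(1) by (intro g) simp
  then have g_eq: "g = \<beta> c" by (simp add: H_def K_def s_0 s'_0)
  have "\<forall>\<^sub>F x in at 0. x \<in> ball 0 \<rho> \<and> (x::complex) \<noteq> 0"
    using \<rho>(1) eventually_at_ball'[of \<rho> 0 UNIV] by (auto elim: eventually_mono)
  then show ?thesis
  proof eventually_elim
    case (elim x)
    then have x: "x \<in> ball 0 r" "x \<noteq> 0" "x \<in> ball 0 d" using \<rho> by blast+
    have "H x = \<beta> c * K x" using g[of x] g_eq elim d(2)[OF x(3)] by (simp add: field_simps)
    moreover have "\<beta> x * deriv \<beta> (c - x) - deriv \<beta> x * \<beta> (c - x) = H x / (s x)\<^sup>2"
      "(\<beta> x)\<^sup>2 - (\<beta> (c - x))\<^sup>2 = K x / (s x)\<^sup>2"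
      using s_nz[OF x(1,2)] by (simp_all add: H_def K_def \<beta>_deriv[OF x(1,2)] \<beta>_s[OF x(1,2)] field_simps power2_eq_square)
    ultimately show ?case by simp
  qed
qed

lemma addition:
  assumes "\<beta> analytic_on {x}" "\<beta> analytic_on {y}" "\<beta> analytic_on {x + y}"
  shows "\<beta> x * deriv \<beta> y - deriv \<beta> x * \<beta> y = \<beta> (x + y) * ((\<beta> x)\<^sup>2 - (\<beta> y)\<^sup>2)"
proof -
  define c where "c = x + y"
  have y: "y = c - x" by (simp add: c_def)
  define F where "F = (\<lambda>x. \<beta> x * deriv \<beta> (c - x) - deriv \<beta> x * \<beta> (c - x) - \<beta> c * ((\<beta> x)\<^sup>2 - (\<beta> (c - x))\<^sup>2))"
  have "F x = 0"
  proof (rule meromorphic_identity[where w = 0 and F = F])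
    show "F meromorphic_on UNIV"
      unfolding F_def by (intro meromorphic_intros mero meromorphic_reflect)
    show "\<forall>\<^sub>F x in at 0. F x = 0"
      using addition_near_0[of c] assms(3) unfolding F_def c_def by (auto elim: eventually_mono)
    show "F analytic_on {x}"
    proof -
      have cx: "\<beta> analytic_on {c - x}" using assms(2) by (simp add: y)
      show ?thesis
        unfolding F_def
        by (intro analytic_on_diff analytic_on_mult analytic_on_power analytic_on_const assms(1)
            analytic_deriv[OF assms(1)] analytic_reflect[OF cx] analytic_reflect[OF analytic_deriv[OF cx]])
    qed
  qed
  then show ?thesis unfolding F_def y by (simp add: c_def)
qed

end

text \<open>
  The convention that a nicely meromorphic function vanishes at its poles is stable under taking
  reciprocals, so beta sn a is again nicely meromorphic. The germ is s x = sn (a x) / a; since s' is 1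
  at 0, it has positive real part on a small ball, and s has no other zero there.
\<close>
lemma jacobi_sn_imp_reciprocal:
  assumes a: "a \<noteq> 0" and sn: "is_jacobi_sn \<kappa> sn"
  obtains s r where "jacobi_reciprocal (beta sn a) s r (\<kappa>\<^sup>2 * a^4) (- (1 + \<kappa>\<^sup>2) * a\<^sup>2)"
proof -
  have sn_nice: "sn nicely_meromorphic_on UNIV" and sn0: "sn 0 = 0"
    and sn': "(sn has_field_derivative 1) (at 0)"
    and ode: "\<And>u. \<not> is_pole sn u \<Longrightarrow> (deriv sn u)\<^sup>2 = (1 - (sn u)\<^sup>2) * (1 - \<kappa>\<^sup>2 * (sn u)\<^sup>2)"
    using sn unfolding is_jacobi_sn_def by blast+
  have "(\<lambda>t. sn (a * t)) nicely_meromorphic_on UNIV"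
    unfolding nicely_meromorphic_on_def
  proof (intro conjI ballI)
    show "(\<lambda>t. sn (a * t)) meromorphic_on UNIV"
    proof (rule meromorphic_on_compose[of sn UNIV])
      show "sn meromorphic_on UNIV" using sn_nice unfolding nicely_meromorphic_on_def by blast
      show "(\<lambda>t. a * t) analytic_on UNIV" by (intro analytic_intros)
    qed simp
    fix z :: complex
    have lim: "filterlim (\<lambda>t. a * t) (at (a * z)) (at z)"
      unfolding filterlim_at using a
      by (auto intro!: tendsto_intros simp: eventually_at_filter)
    show "is_pole (\<lambda>t. sn (a * t)) z \<and> sn (a * z) = 0 \<or> (\<lambda>t. sn (a * t)) \<midarrow>z\<rightarrow> sn (a * z)"
      using sn_nice filterlim_compose[OF _ lim, of sn] unfolding nicely_meromorphic_on_def is_pole_def by blast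
  qed
  then have "(\<lambda>t. a * inverse (sn (a * t))) nicely_meromorphic_on UNIV"
    by (intro nicely_meromorphic_on_cmult_left nicely_meromorphic_on_inverse)
  then have nice: "beta sn a nicely_meromorphic_on UNIV"
    by (simp add: beta_def[abs_def] divide_inverse)
  have "\<not> is_pole sn 0"
    using DERIV_isCont[OF sn'] not_tendsto_and_filterlim_at_infinity[of "at 0" sn "sn 0"]
    by (auto simp: isCont_def is_pole_def)
  then have "sn analytic_on {0}" using nicely_meromorphic_on_imp_analytic_at[OF sn_nice] by simp
  then obtain e where e: "e > 0" "sn holomorphic_on ball 0 e" using analytic_at_ball by blast
  define s where "s = (\<lambda>x. sn (a * x) / a)"
  define r0 where "r0 = e / norm a"
  have r0: "r0 > 0" using e a by (simp add: r0_def)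
  have in_e: "a * x \<in> ball 0 e" if "x \<in> ball 0 r0" for x
    using that a by (simp add: r0_def norm_mult field_simps)
  have s': "(s has_field_derivative deriv sn (a * x)) (at x)" if "x \<in> ball 0 r0" for x
  proof -
    have "((\<lambda>x. sn (a * x)) has_field_derivative deriv sn (a * x) * a) (at x)"
    proof (rule DERIV_chain2[where f = sn and g = "\<lambda>x. a * x"])
      show "(sn has_field_derivative deriv sn (a * x)) (at (a * x))"
        by (rule holomorphic_derivI[OF e(2) open_ball in_e[OF that]])
      show "((\<lambda>x. a * x) has_field_derivative a) (at x)" by (auto intro!: derivative_eq_intros)
    qed
    from DERIV_cdivide[OF this, of a] a show ?thesis by (simp add: s_def)
  qed
  have ds: "deriv s x = deriv sn (a * x)" if "x \<in> ball 0 r0" for x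
    by (rule DERIV_imp_deriv[OF s'[OF that]])
  have hs: "s holomorphic_on ball 0 r0"
    unfolding holomorphic_on_open[OF open_ball] using s' by blast
  have s0: "s 0 = 0" by (simp add: s_def sn0)
  have ds0: "deriv s 0 = 1" using ds[of 0] r0 DERIV_imp_deriv[OF sn'] by simp
  have "isCont (deriv s) 0"
    using holomorphic_on_imp_continuous_on[OF holomorphic_deriv[OF hs open_ball]] r0
    by (simp add: continuous_on_eq_continuous_at)
  then have "(deriv s \<longlongrightarrow> 1) (at 0)" using ds0 by (simp add: isCont_def)
  from tendsto_Re[OF this] have "((\<lambda>x. Re (deriv s x)) \<longlongrightarrow> 1) (at 0)" by simp
  then have ev1: "\<forall>\<^sub>F x in at 0. Re (deriv s x) > 0" by (rule order_tendstoD) simp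
  have "(s has_field_derivative 1) (at 0)" using s'[of 0] r0 DERIV_imp_deriv[OF sn'] by simp
  then have "((\<lambda>x. s x / x) \<longlongrightarrow> 1) (at 0)" by (simp add: has_field_derivative_iff s0)
  then have "\<forall>\<^sub>F x in at 0. s x / x \<noteq> 0" by (rule tendsto_imp_eventually_ne) simp
  with ev1 have "\<forall>\<^sub>F x in at 0. Re (deriv s x) > 0 \<and> s x \<noteq> 0" by eventually_elim auto
  then obtain d where d: "d > 0" "\<And>x. x \<noteq> 0 \<Longrightarrow> dist x 0 < d \<Longrightarrow> Re (deriv s x) > 0 \<and> s x \<noteq> 0"
    unfolding eventually_at by blast
  define r where "r = min r0 d"
  have "jacobi_reciprocal (beta sn a) s r (\<kappa>\<^sup>2 * a^4) (- (1 + \<kappa>\<^sup>2) * a\<^sup>2)"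
  proof
    show "r > 0" using r0 d by (simp add: r_def)
    show "s holomorphic_on ball 0 r" by (rule holomorphic_on_subset[OF hs]) (auto simp: r_def)
    fix x :: complex assume x: "x \<in> ball 0 r"
    then have x0: "x \<in> ball 0 r0" and xd: "dist x 0 < d" by (auto simp: r_def dist_commute)
    show "Re (deriv s x) > 0"
    proof (cases "x = 0")
      case True
      then show ?thesis by (simp add: ds0)
    next
      case False
      from d(2)[OF this xd] show ?thesis by simp
    qed
    have "\<not> is_pole sn (a * x)"
      by (rule analytic_at_imp_no_pole[OF holomorphic_on_imp_analytic_at[OF e(2) open_ball in_e[OF x0]]])
    from ode[OF this] have "(deriv s x)\<^sup>2 = (1 - (sn (a * x))\<^sup>2) * (1 - \<kappa>\<^sup>2 * (sn (a * x))\<^sup>2)"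
      by (simp only: ds[OF x0])
    moreover have "sn (a * x) = a * s x" using a by (simp add: s_def)
    ultimately show "(deriv s x)\<^sup>2 = 1 + - (1 + \<kappa>\<^sup>2) * a\<^sup>2 * (s x)\<^sup>2 + \<kappa>\<^sup>2 * a^4 * (s x)^4"
      by algebra
    show "beta sn a x = 1 / s x" by (simp add: beta_def s_def)
    show "s x \<noteq> 0" if "x \<noteq> 0" using d(2)[OF that xd] by simp
  qed (rule nice s0 ds0)+
  then show ?thesis by (rule that)
qed

section \<open>Commutators of the matrix operators\<close>

text \<open>
  sum_pd and mixed_pd are the first and second elementary symmetric polynomials in the partial
  derivatives.
\<close>
definition sum_pd :: "(complex^3 \<Rightarrow> complex) \<Rightarrow> complex^3 \<Rightarrow> complex" where
  "sum_pd g t = pd 1 g t + pd 2 g t + pd 3 g t"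

definition mixed_pd :: "(complex^3 \<Rightarrow> complex) \<Rightarrow> complex^3 \<Rightarrow> complex" where
  "mixed_pd g t = pd 1 (pd 2 g) t + pd 2 (pd 3 g) t + pd 3 (pd 1 g) t"

lemma distinct_3_cases:
  assumes "distinct [i, j, n :: 3]"
  obtains "i = 1" "j = 2" "n = 3" | "i = 1" "j = 3" "n = 2" | "i = 2" "j = 1" "n = 3"
    | "i = 2" "j = 3" "n = 1" | "i = 3" "j = 1" "n = 2" | "i = 3" "j = 2" "n = 1"
  using assms exhaust_3[of i] exhaust_3[of j] exhaust_3[of n]
  by (elim disjE) (simp_all only: distinct.simps list.set, blast+)

lemma distinct_3_neq:
  "distinct [i, j, n] \<Longrightarrow> i \<noteq> j" "distinct [i, j, n] \<Longrightarrow> j \<noteq> i" "distinct [i, j, n] \<Longrightarrow> i \<noteq> n"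
  "distinct [i, j, n] \<Longrightarrow> n \<noteq> i" "distinct [i, j, n] \<Longrightarrow> j \<noteq> n" "distinct [i, j, n] \<Longrightarrow> n \<noteq> j"
  by auto

lemma complete_triple:
  fixes i j :: 3
  assumes "i \<noteq> j"
  obtains n where "distinct [i, j, n]"
proof -
  have "distinct [i, j, 1] \<or> distinct [i, j, 2] \<or> distinct [i, j, 3]"
    using assms exhaust_3[of i] exhaust_3[of j] by (elim disjE) simp_all
  then show ?thesis using that by blast
qed

text \<open>
  Rows of the matrices are labelled by i together with the two remaining indices j and n in
  some order. Since \<beta> is odd, all rows then have the same form and need only one calculation.
\<close>
lemma ex_complete_triple:
  fixes i :: 3
  obtains j n where "distinct [i, j, n]"
proof -
  have "i \<noteq> 1 \<or> i \<noteq> 2" by (cases "i = 1") simp_all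
  then show ?thesis using that complete_triple[of i 1] complete_triple[of i 2] by blast
qed

text \<open>
  The commutation relations use only that the coefficient function is odd, and satisfies the
  addition formula, on the differences of coordinates that occur on an open set U.
\<close>
locale calogero_coefficients =
  fixes \<beta> :: "complex \<Rightarrow> complex" and U :: "(complex^3) set" and k :: complex
  assumes U: "open U"
    and analytic: "t \<in> U \<Longrightarrow> i \<noteq> j \<Longrightarrow> \<beta> analytic_on {t $ i - t $ j}"
    and odd: "t \<in> U \<Longrightarrow> i \<noteq> j \<Longrightarrow> \<beta> (t $ j - t $ i) = - \<beta> (t $ i - t $ j)"
    and addition: "t \<in> U \<Longrightarrow> distinct [i, j, n] \<Longrightarrow>
      \<beta> (t $ i - t $ n) * deriv \<beta> (t $ n - t $ j) - deriv \<beta> (t $ i - t $ n) * \<beta> (t $ n - t $ j)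
        = \<beta> (t $ i - t $ j) * ((\<beta> (t $ i - t $ n))\<^sup>2 - (\<beta> (t $ n - t $ j))\<^sup>2)"
begin

definition b :: "3 \<Rightarrow> 3 \<Rightarrow> complex^3 \<Rightarrow> complex" where "b i j t = \<beta> (t $ i - t $ j)"
definition d :: "3 \<Rightarrow> 3 \<Rightarrow> complex^3 \<Rightarrow> complex" where "d i j t = deriv \<beta> (t $ i - t $ j)"

lemmas holo_intros = holo_on_add holo_on_mult holo_on_cmult holo_on_pd[OF U]

lemma analytic': "t \<in> U \<Longrightarrow> i \<noteq> j \<Longrightarrow> deriv \<beta> analytic_on {t $ i - t $ j}"
  by (intro analytic_deriv analytic)

lemma holo_b: "i \<noteq> j \<Longrightarrow> holo_on (b i j) U"
  unfolding b_def[abs_def] by (rule holo_on_difference) (rule analytic)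

lemma holo_d: "i \<noteq> j \<Longrightarrow> holo_on (d i j) U"
  unfolding d_def[abs_def] by (rule holo_on_difference) (rule analytic')

lemma pd_b: "i \<noteq> j \<Longrightarrow> t \<in> U \<Longrightarrow> pd l (b i j) t = (of_bool (l = i) - of_bool (l = j)) * d i j t"
  unfolding b_def[abs_def] d_def by (rule pd_difference) (rule analytic)

lemma b_flip: "i \<noteq> j \<Longrightarrow> t \<in> U \<Longrightarrow> b j i t = - b i j t"
  unfolding b_def by (rule odd)

text \<open>
  Oddness of \<beta> is assumed on differences of coordinates only; differentiating it along the
  i-th coordinate gives the evenness of \<beta>'.
\<close>
lemma d_flip:
  assumes "i \<noteq> j" "t \<in> U"
  shows "d j i t = d i j t"
proof -
  have "pd i (b j i) t = pd i (\<lambda>t. - 1 * b i j t) t"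
    by (rule pd_cong[OF U assms(2)]) (simp add: b_flip[OF assms(1)])
  also have "\<dots> = - 1 * pd i (b i j) t"
    by (rule pd_cmult[OF holo_b[OF assms(1)] assms(2)])
  finally show ?thesis
    using assms by (simp add: pd_b)
qed

lemma sum_pd_eq:
  assumes "distinct [i, j, n]"
  shows "sum_pd g t = pd i g t + pd j g t + pd n g t"
  using assms unfolding sum_pd_def by (cases rule: distinct_3_cases) (simp_all add: ac_simps)

lemma mixed_pd_eq:
  assumes "distinct [i, j, n]" "holo_on g U" "t \<in> U"
  shows "mixed_pd g t = pd i (pd j g) t + pd j (pd n g) t + pd n (pd i g) t"
proof -
  note C = pd_commute[OF U assms(2,3)]
  have "pd 2 (pd 1 g) t = pd 1 (pd 2 g) t" "pd 3 (pd 2 g) t = pd 2 (pd 3 g) t" "pd 1 (pd 3 g) t = pd 3 (pd 1 g) t"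
    by (rule C)+
  note swap = this
  show ?thesis
    using assms(1) unfolding mixed_pd_def
    by (cases rule: distinct_3_cases) (simp_all only: swap add.commute add.left_commute)
qed

lemma sum_pd_b:
  assumes "i \<noteq> j" "t \<in> U"
  shows "sum_pd (b i j) t = 0"
proof -
  obtain n where ijn: "distinct [i, j, n]" using complete_triple[OF assms(1)] by blast
  show ?thesis unfolding sum_pd_eq[OF ijn] pd_b[OF assms] by (simp add: distinct_3_neq[OF ijn])
qed

lemma sum_pd_d:
  assumes "i \<noteq> j" "t \<in> U"
  shows "sum_pd (d i j) t = 0"
proof -
  obtain n where ijn: "distinct [i, j, n]" using complete_triple[OF assms(1)] by blast
  have "pd l (d i j) t = (of_bool (l = i) - of_bool (l = j)) * deriv (deriv \<beta>) (t $ i - t $ j)" for l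
    unfolding d_def[abs_def] by (rule pd_difference[OF _ assms(2)]) (rule analytic'[OF _ assms(1)])
  then show ?thesis unfolding sum_pd_eq[OF ijn] by (simp add: distinct_3_neq[OF ijn])
qed

lemma sum_pd_cong: "(\<And>x. x \<in> U \<Longrightarrow> g x = h x) \<Longrightarrow> t \<in> U \<Longrightarrow> sum_pd g t = sum_pd h t"
  unfolding sum_pd_def by (simp only: pd_cong[OF U, of t g h])

lemma mixed_pd_cong:
  assumes "\<And>x. x \<in> U \<Longrightarrow> g x = h x" "t \<in> U"
  shows "mixed_pd g t = mixed_pd h t"
proof -
  have "pd i (pd j g) t = pd i (pd j h) t" for i j
    by (rule pd_cong[OF U assms(2)]) (rule pd_cong[OF U _ assms(1)])
  then show ?thesis by (simp add: mixed_pd_def)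
qed

lemma holo_mixed_pd: "holo_on g U \<Longrightarrow> holo_on (mixed_pd g) U"
  unfolding mixed_pd_def[abs_def] by (intro holo_intros)

context
  fixes t assumes t: "t \<in> U"
begin

lemma sum_pd_add:
  "holo_on g U \<Longrightarrow> holo_on h U \<Longrightarrow>
    sum_pd (\<lambda>t. g t + h t) t = sum_pd g t + sum_pd h t"
  by (simp add: sum_pd_def pd_add[OF _ _ t])

lemma sum_pd_mult:
  "holo_on g U \<Longrightarrow> holo_on h U \<Longrightarrow>
    sum_pd (\<lambda>t. g t * h t) t = g t * sum_pd h t + sum_pd g t * h t"
  by (simp add: sum_pd_def pd_mult[OF _ _ t] algebra_simps)

lemma sum_pd_cmult: "holo_on g U \<Longrightarrow> sum_pd (\<lambda>t. c * g t) t = c * sum_pd g t"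
  by (simp add: sum_pd_def pd_cmult[OF _ t] algebra_simps)

lemma sum_pd_pd:
  assumes g: "holo_on g U"
  shows "sum_pd (pd i g) t = pd i (sum_pd g) t"
proof -
  have "pd i (sum_pd g) t = pd i (pd 1 g) t + pd i (pd 2 g) t + pd i (pd 3 g) t"
    unfolding sum_pd_def[abs_def] by (simp add: pd_add[OF _ _ t] holo_intros g)
  then show ?thesis
    unfolding sum_pd_def by (simp only: pd_commute[OF U g t, of _ i])
qed

lemma mixed_pd_add:
  "holo_on g U \<Longrightarrow> holo_on h U \<Longrightarrow>
    mixed_pd (\<lambda>t. g t + h t) t = mixed_pd g t + mixed_pd h t"
  by (simp add: mixed_pd_def pd_pd_add[OF U _ _ t])

lemma mixed_pd_cmult: "holo_on g U \<Longrightarrow> mixed_pd (\<lambda>t. c * g t) t = c * mixed_pd g t"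
  by (simp add: mixed_pd_def pd_pd_cmult[OF U _ t] algebra_simps)

end

lemma pd_mixed_pd:
  assumes g: "holo_on g U" and t: "t \<in> U"
  shows "pd i (mixed_pd g) t = mixed_pd (pd i g) t"
proof -
  have "pd i (pd a (pd b g)) t = pd a (pd b (pd i g)) t" for a b
  proof -
    have "pd i (pd a (pd b g)) t = pd a (pd i (pd b g)) t"
      by (rule pd_commute[OF U holo_on_pd[OF U g] t])
    also have "\<dots> = pd a (pd b (pd i g)) t"
      by (rule pd_cong[OF U t]) (rule pd_commute[OF U g])
    finally show ?thesis .
  qed
  then show ?thesis
    unfolding mixed_pd_def[abs_def] using g t by (simp add: pd_add[OF _ _ t] holo_intros)
qed

lemma sum_pd_mixed_pd:
  assumes g: "holo_on g U" and t: "t \<in> U"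
  shows "sum_pd (mixed_pd g) t = mixed_pd (sum_pd g) t"
proof -
  have "sum_pd (mixed_pd g) t = mixed_pd (pd 1 g) t + mixed_pd (pd 2 g) t + mixed_pd (pd 3 g) t"
    by (simp add: sum_pd_def pd_mixed_pd[OF g t])
  also have "\<dots> = mixed_pd (sum_pd g) t"
    unfolding sum_pd_def[abs_def] by (simp add: mixed_pd_add[OF t] holo_intros g)
  finally show ?thesis .
qed

text \<open>
  The commutator of the second-order part with a multiplication operator \<beta>(t_i - t_j). Terms with a
  derivative along the third axis cancel because \<partial>_i + \<partial>_j annihilates the factor.
\<close>
lemma mixed_pd_b_mult:
  assumes "distinct [i, j, n]" "holo_on g U" "t \<in> U"
  shows "mixed_pd (\<lambda>t. b i j t * g t) t
    = b i j t * mixed_pd g t + d i j t * (pd j g t - pd i g t) - deriv (deriv \<beta>) (t $ i - t $ j) * g t"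
proof -
  have ij: "i \<noteq> j" using assms(1) by simp
  note bg = holo_on_mult[OF holo_b[OF ij] assms(2)]
  have dd: "pd l (pd m (b i j)) t = (of_bool (l = i) - of_bool (l = j)) * (of_bool (m = i) - of_bool (m = j))
      * deriv (deriv \<beta>) (t $ i - t $ j)" for l m
    unfolding b_def[abs_def] by (rule pd_pd_difference[OF U _ assms(3)]) (rule analytic[OF _ ij])
  show ?thesis
    unfolding mixed_pd_eq[OF assms(1) bg assms(3)] mixed_pd_eq[OF assms] pd_pd_mult[OF U holo_b[OF ij] assms(2,3)]
      pd_b[OF ij assms(3)] dd
    by (simp add: distinct_3_neq[OF assms(1)] algebra_simps)
qed

text \<open>
  The rows of P2 and Q1 in terms of b and d. The second and third argument are the two indices
  other than the row index, in either order.
\<close>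
definition P2_entry :: "3 \<Rightarrow> 3 \<Rightarrow> 3 \<Rightarrow> vfun \<Rightarrow> complex^3 \<Rightarrow> complex" where
  "P2_entry i j n f t = mixed_pd (\<lambda>t. f t $ i) t
     + k * (k - 1) * (b i j t * b i j t + b i n t * b i n t + b j n t * b j n t) * f t $ i
     + k * ((b i j t * b i j t + b i n t * b i n t) * f t $ i + d i j t * f t $ j + d i n t * f t $ n)"

definition Q1_entry :: "3 \<Rightarrow> 3 \<Rightarrow> 3 \<Rightarrow> vfun \<Rightarrow> complex^3 \<Rightarrow> complex" where
  "Q1_entry i j n f t = pd i (\<lambda>t. f t $ i) t - k * (b i j t * f t $ j + b i n t * f t $ n)"

lemma P1_nth: "P1 f t $ i = sum_pd (\<lambda>t. f t $ i) t"
  by (simp add: P1_def sum_pd_def partial_nth)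

lemma Q1_nth:
  assumes "distinct [i, j, n]" "t \<in> U"
  shows "Q1 k \<beta> f t $ i = Q1_entry i j n f t"
proof -
  have "b 2 1 t = - b 1 2 t" "b 3 1 t = - b 1 3 t" "b 3 2 t = - b 2 3 t"
    using b_flip[of 1 2] b_flip[of 1 3] b_flip[of 2 3] assms(2) by simp_all
  with assms(1) show ?thesis
    by (cases rule: distinct_3_cases)
      (simp_all add: Q1_entry_def Q1_def Q1_matrix_def Let_def matrix_vector_mult_def sum_3 partial_nth algebra_simps
        flip: b_def)
qed

lemma P2_nth:
  assumes "distinct [i, j, n]" "t \<in> U"
  shows "P2 k \<beta> f t $ i = P2_entry i j n f t"
proof -
  have "b 2 1 t = - b 1 2 t" "b 3 1 t = - b 1 3 t" "b 3 2 t = - b 2 3 t"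
    "d 2 1 t = d 1 2 t" "d 3 1 t = d 1 3 t" "d 3 2 t = d 2 3 t"
    using b_flip[of 1 2] b_flip[of 1 3] b_flip[of 2 3] d_flip[of 1 2] d_flip[of 1 3] d_flip[of 2 3] assms(2)
    by simp_all
  with assms(1) show ?thesis
    by (cases rule: distinct_3_cases)
      (simp_all add: P2_entry_def P2_def P2_matrix_def Let_def matrix_vector_mult_def sum_3 partial_nth mixed_pd_def
        power2_eq_square algebra_simps flip: b_def d_def)
qed

context
  fixes f :: vfun and t
  assumes f: "f holomorphic3_on U" and t: "t \<in> U"
begin

lemmas fh = holomorphic3_on_component[OF f]

text \<open>
  sum_pd is a derivation that annihilates b and d and commutes with partial derivatives, so
  it passes through every term of P2.
\<close>
lemma P1_P2: "P1 (P2 k \<beta> f) t = P2 k \<beta> (P1 f) t"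
proof (rule vec_eq_iff[THEN iffD2], rule allI)
  fix i :: 3
  obtain j n where ijn: "distinct [i, j, n]" by (rule ex_complete_triple)
  have "P1 (P2 k \<beta> f) t $ i = sum_pd (P2_entry i j n f) t"
    unfolding P1_nth by (rule sum_pd_cong[OF _ t]) (rule P2_nth[OF ijn])
  also have "\<dots> = sum_pd (mixed_pd (\<lambda>t. f t $ i)) t
     + k * (k - 1) * (b i j t * b i j t + b i n t * b i n t + b j n t * b j n t) * sum_pd (\<lambda>t. f t $ i) t
     + k * ((b i j t * b i j t + b i n t * b i n t) * sum_pd (\<lambda>t. f t $ i) t
          + d i j t * sum_pd (\<lambda>t. f t $ j) t + d i n t * sum_pd (\<lambda>t. f t $ n) t)"
    unfolding P2_entry_def[abs_def]
    by (simp add: distinct_3_neq[OF ijn] sum_pd_add[OF t] sum_pd_cmult[OF t] sum_pd_mult[OF t]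
        holo_intros holo_b holo_d holo_mixed_pd fh sum_pd_b[OF _ t] sum_pd_d[OF _ t] mult.assoc)
  also have "\<dots> = P2_entry i j n (P1 f) t"
    by (simp add: P2_entry_def P1_nth sum_pd_mixed_pd[OF fh t])
  also have "\<dots> = P2 k \<beta> (P1 f) t $ i"
    by (rule P2_nth[OF ijn t, symmetric])
  finally show "P1 (P2 k \<beta> f) t $ i = P2 k \<beta> (P1 f) t $ i" .
qed

lemma Q1_entry_eq: "Q1_entry i j n f = (\<lambda>t. pd i (\<lambda>t. f t $ i) t + (- k) * (b i j t * f t $ j + b i n t * f t $ n))"
  by (simp add: Q1_entry_def fun_eq_iff)

lemma P1_Q1: "P1 (Q1 k \<beta> f) t = Q1 k \<beta> (P1 f) t"
proof (rule vec_eq_iff[THEN iffD2], rule allI)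
  fix i :: 3
  obtain j n where ijn: "distinct [i, j, n]" by (rule ex_complete_triple)
  have "P1 (Q1 k \<beta> f) t $ i = sum_pd (Q1_entry i j n f) t"
    unfolding P1_nth by (rule sum_pd_cong[OF _ t]) (rule Q1_nth[OF ijn])
  also have "\<dots> = sum_pd (pd i (\<lambda>t. f t $ i)) t
     + (- k) * (b i j t * sum_pd (\<lambda>t. f t $ j) t + b i n t * sum_pd (\<lambda>t. f t $ n) t)"
    unfolding Q1_entry_eq
    by (simp only: sum_pd_add[OF t] sum_pd_cmult[OF t] sum_pd_mult[OF t] holo_intros holo_b fh
        sum_pd_b[OF _ t] distinct_3_neq[OF ijn] not_False_eq_True) simp
  also have "\<dots> = Q1_entry i j n (P1 f) t"
    by (simp add: Q1_entry_def P1_nth sum_pd_pd[OF t fh])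
  also have "\<dots> = Q1 k \<beta> (P1 f) t $ i"
    by (rule Q1_nth[OF ijn t, symmetric])
  finally show "P1 (Q1 k \<beta> f) t $ i = Q1 k \<beta> (P1 f) t $ i" .
qed

text \<open>
  The i-th components of both sides are expanded with the product rule; what remains is a polynomial
  identity in b, d, \<beta>'' and the derivatives of f, up to two instances of the addition formula.
\<close>
lemma P2_Q1: "P2 k \<beta> (Q1 k \<beta> f) t = Q1 k \<beta> (P2 k \<beta> f) t"
proof (rule vec_eq_iff[THEN iffD2], rule allI)
  fix i :: 3
  obtain j n where ijn: "distinct [i, j, n]" by (rule ex_complete_triple)
  then have jin: "distinct [j, i, n]" and nij: "distinct [n, i, j]" and inj: "distinct [i, n, j]"
    by auto
  note ne = distinct_3_neq[OF ijn]
  define fi fj fn where "fi = (\<lambda>t. f t $ i)" and "fj = (\<lambda>t. f t $ j)" and "fn = (\<lambda>t. f t $ n)"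
  then have comp: "f x $ i = fi x" "f x $ j = fj x" "f x $ n = fn x" for x
    by simp_all
  have h: "holo_on fi U" "holo_on fj U" "holo_on fn U"
    using fh by (simp_all add: fi_def fj_def fn_def)
  have "mixed_pd (\<lambda>t. Q1 k \<beta> f t $ i) t = mixed_pd (Q1_entry i j n f) t"
    by (rule mixed_pd_cong[OF _ t]) (rule Q1_nth[OF ijn])
  also have "\<dots> = mixed_pd (pd i fi) t
      - k * (mixed_pd (\<lambda>t. b i j t * fj t) t + mixed_pd (\<lambda>t. b i n t * fn t) t)"
    unfolding Q1_entry_eq comp
    by (simp only: mixed_pd_add[OF t] mixed_pd_cmult[OF t] holo_intros holo_b h ne not_False_eq_True) simp
  also have "\<dots> = mixed_pd (pd i fi) t
      - k * (b i j t * mixed_pd fj t + d i j t * (pd j fj t - pd i fj t)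
          - deriv (deriv \<beta>) (t $ i - t $ j) * fj t
        + (b i n t * mixed_pd fn t + d i n t * (pd n fn t - pd i fn t)
          - deriv (deriv \<beta>) (t $ i - t $ n) * fn t))"
    by (simp only: mixed_pd_b_mult[OF ijn h(2) t] mixed_pd_b_mult[OF inj h(3) t])
  finally have A: "mixed_pd (\<lambda>t. Q1 k \<beta> f t $ i) t = \<dots>" .
  have pd_d: "pd i (d i l) t = deriv (deriv \<beta>) (t $ i - t $ l)" if "i \<noteq> l" for l
    unfolding d_def[abs_def] using that t
    by (subst pd_difference[OF analytic']) auto
  have "pd i (\<lambda>t. P2 k \<beta> f t $ i) t = pd i (P2_entry i j n f) t"
    by (rule pd_cong[OF U t]) (rule P2_nth[OF ijn])
  also have "\<dots> = mixed_pd (pd i fi) t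
      + k * (k - 1) * ((b i j t * b i j t + b i n t * b i n t + b j n t * b j n t) * pd i fi t
          + (2 * b i j t * d i j t + 2 * b i n t * d i n t) * fi t)
      + k * ((b i j t * b i j t + b i n t * b i n t) * pd i fi t
          + (2 * b i j t * d i j t + 2 * b i n t * d i n t) * fi t
          + d i j t * pd i fj t + deriv (deriv \<beta>) (t $ i - t $ j) * fj t
          + d i n t * pd i fn t + deriv (deriv \<beta>) (t $ i - t $ n) * fn t)"
    unfolding P2_entry_def[abs_def] comp
    by (simp add: pd_add[OF _ _ t] pd_cmult[OF _ t] pd_mult[OF _ _ t] holo_intros holo_b holo_d holo_mixed_pd h ne
        pd_b[OF _ t] pd_d pd_mixed_pd[OF h(1) t] mult.assoc)
  finally have B: "pd i (\<lambda>t. P2 k \<beta> f t $ i) t = \<dots>" .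
  \<comment> \<open>All coefficients are expressed through the pairs (i,j), (i,n) and (j,n).\<close>
  have flips: "b j i t = - b i j t" "b n i t = - b i n t" "b n j t = - b j n t"
     "d j i t = d i j t" "d n i t = d i n t" "d n j t = d j n t"
    by (rule b_flip d_flip, rule ne, rule t)+
  have add1: "b i n t * d n j t - d i n t * b n j t = b i j t * ((b i n t)\<^sup>2 - (b n j t)\<^sup>2)"
    using addition[OF t ijn] by (simp add: b_def d_def)
  have add2: "b i j t * d j n t - d i j t * b j n t = b i n t * ((b i j t)\<^sup>2 - (b j n t)\<^sup>2)"
    using addition[OF t inj] by (simp add: b_def d_def)
  \<comment> \<open>All terms with derivatives of f cancel, and so do those with f $ i. The coefficients of f $ j and
      f $ n are off-diagonal entries of the commutator of the two coefficient matrices.\<close>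
  have "P2_entry i j n (Q1 k \<beta> f) t - Q1_entry i j n (P2 k \<beta> f) t
     = k\<^sup>2 * (fj t * (b i n t * d n j t - d i n t * b n j t - b i j t * ((b i n t)\<^sup>2 - (b n j t)\<^sup>2))
       + fn t * (b i j t * d j n t - d i j t * b j n t - b i n t * ((b i j t)\<^sup>2 - (b j n t)\<^sup>2)))"
    unfolding P2_entry_def[of i j n "Q1 k \<beta> f"] Q1_entry_def[of i j n "P2 k \<beta> f"] A B
      Q1_nth[OF ijn t] Q1_nth[OF jin t] Q1_nth[OF nij t] P2_nth[OF jin t] P2_nth[OF nij t]
    unfolding P2_entry_def Q1_entry_def comp flips
    by algebra
  then have "P2_entry i j n (Q1 k \<beta> f) t = Q1_entry i j n (P2 k \<beta> f) t"
    using add1 add2 by simp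
  then show "P2 k \<beta> (Q1 k \<beta> f) t $ i = Q1 k \<beta> (P2 k \<beta> f) t $ i"
    by (simp only: P2_nth[OF ijn t] Q1_nth[OF ijn t])
qed

end

end

theorem theorem3p2:
  fixes k a \<kappa> :: complex and sn \<beta> :: "complex \<Rightarrow> complex"
  assumes "a \<noteq> 0"
    and "is_jacobi_sn \<kappa> sn"
    and "\<beta> = beta sn a"
  shows "commute_on (regular_set \<beta>) P1 (P2 k \<beta>) \<and>
         commute_on (regular_set \<beta>) P1 (Q1 k \<beta>) \<and>
         commute_on (regular_set \<beta>) (P2 k \<beta>) (Q1 k \<beta>)"
proof -
  obtain s r where "jacobi_reciprocal (beta sn a) s r (\<kappa>\<^sup>2 * a^4) (- (1 + \<kappa>\<^sup>2) * a\<^sup>2)"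
    by (rule jacobi_sn_imp_reciprocal[OF assms(1,2)])
  then interpret jacobi_reciprocal \<beta> s r "\<kappa>\<^sup>2 * a^4" "- (1 + \<kappa>\<^sup>2) * a\<^sup>2"
    by (simp only: assms(3))
  have calogero: "calogero_coefficients \<beta> U" if U: "open U" "U \<subseteq> regular_set \<beta>" for U
  proof
    show "open U" by fact
    have an: "\<beta> analytic_on {t $ i - t $ j}" if "t \<in> U" "i \<noteq> j" for t i j
    proof (rule nicely_meromorphic_on_imp_analytic_at[OF nicely UNIV_I])
      show "\<not> is_pole \<beta> (t $ i - t $ j)"
        using U(2) that unfolding regular_set_def by blast
    qed
    fix t i j assume t: "t \<in> U"
    show "\<beta> analytic_on {t $ i - t $ j}" if "i \<noteq> j" by (rule an[OF t that])
    show "\<beta> (t $ j - t $ i) = - \<beta> (t $ i - t $ j)" if "i \<noteq> j"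
      using \<beta>_odd[OF an[OF t that]] an[OF t that[symmetric]] by simp
    fix n assume "distinct [i, j, n]"
    note ne = distinct_3_neq[OF this]
    show "\<beta> (t $ i - t $ n) * deriv \<beta> (t $ n - t $ j) - deriv \<beta> (t $ i - t $ n) * \<beta> (t $ n - t $ j)
        = \<beta> (t $ i - t $ j) * ((\<beta> (t $ i - t $ n))\<^sup>2 - (\<beta> (t $ n - t $ j))\<^sup>2)"
      using addition[OF an[OF t, of i n] an[OF t, of n j]] an[OF t, of i j] ne by simp
  qed
  show ?thesis
    unfolding commute_on_def
  proof (intro conjI allI impI ballI; elim conjE)
    fix U f t
    assume U: "open U" "U \<subseteq> regular_set \<beta>" and f: "f holomorphic3_on U" and t: "t \<in> U"
    interpret calogero_coefficients \<beta> U k by (rule calogero[OF U])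
    show "P1 (P2 k \<beta> f) t = P2 k \<beta> (P1 f) t" by (rule P1_P2[OF f t])
    show "P1 (Q1 k \<beta> f) t = Q1 k \<beta> (P1 f) t" by (rule P1_Q1[OF f t])
    show "P2 k \<beta> (Q1 k \<beta> f) t = Q1 k \<beta> (P2 k \<beta> f) t" by (rule P2_Q1[OF f t])
  qed
qed

end
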